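(* Let $\alpha\in(0,2]$ and let $\xi=(q_1\xi_1,q_2\xi_2,\dots,q_n\xi_n,\dots)$, where $q_k>0$ for all $k\ge1$ and $\sum_{k\ge1}q_k^\alpha<\infty$, so that $\xi$ is an $\ell^2$-valued random variable. Let $u=(u_k),v=(v_k)\in\ell^2$ be such that $$\sum_{k\ge1}\frac{|u_k-v_k|^2}{q_k^2}<\infty .$$ Then the law of the random variable $\xi+u$ and the law of $\xi+v$ are equivalent. In addition, if $\mu$ and $\nu$ denote the laws of $\xi+u$ and $\xi+v$ respectively, the density $\frac{d\mu}{d\nu}$ of $\mu$ with respect to $\nu$ is given by $$\frac{d\mu}{d\nu}=\lim_{N\to\infty}\prod_{k=1}^N\frac{p_\alpha\big(\frac{z_k-u_k}{q_k}\big)}{p_\alpha\big(\frac{z_k-v_k}{q_k}\big)}\qquad\text{in }L^1(\nu),$$ where $z=(z_k)\in\ell^2$ denotes the variable.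
   Context: $(\xi_n)_{n\ge1}$ is a sequence of independent real random variables on a probability space, all having the law $\mu_\alpha$, the normalized symmetric $\alpha$-stable distribution on $\mathbb R$ with characteristic function $\hat\mu_\alpha(s)=e^{-|s|^\alpha}$, $s\in\mathbb R$. $p_\alpha$ is the density of $\mu_\alpha$ with respect to Lebesgue measure. The condition $\sum_kq_k^\alpha<\infty$ guarantees $\xi\in\ell^2$ $\mathbb P$-a.s. Two measures are equivalent if each is absolutely continuous with respect to the other. *)

theory Defs
  imports "HOL-Probability.Probability"
begin

text \<open>The real Hilbert space of square-summable sequences, indexed from 0.\<close>

typedef ell2 = "{x :: nat \<Rightarrow> real. summable (\<lambda>k. (x k)\<^sup>2)}"
  morphisms coord Abs_ell2
  by (rule exI[of _ "\<lambda>_. 0"]) simp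

setup_lifting type_definition_ell2

lemma summable_coord_sq: "summable (\<lambda>k. (coord x k)\<^sup>2)"
  using coord[of x] by simp

lemma summable_prod_of_sq:
  fixes x y :: "nat \<Rightarrow> real"
  assumes "summable (\<lambda>k. (x k)\<^sup>2)" "summable (\<lambda>k. (y k)\<^sup>2)"
  shows "summable (\<lambda>k. x k * y k)"
proof (rule summable_comparison_test'[of "\<lambda>k. (x k)\<^sup>2 + (y k)\<^sup>2" 0])
  show "summable (\<lambda>k. (x k)\<^sup>2 + (y k)\<^sup>2)"
    using assms by (rule summable_add)
  fix k :: nat
  have "2 * (\<bar>x k\<bar> * \<bar>y k\<bar>) \<le> (x k)\<^sup>2 + (y k)\<^sup>2"
    using sum_squares_bound[of "\<bar>x k\<bar>" "\<bar>y k\<bar>"] by (simp add: mult.assoc)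
  moreover have "0 \<le> \<bar>x k\<bar> * \<bar>y k\<bar>" by simp
  ultimately show "norm (x k * y k) \<le> (x k)\<^sup>2 + (y k)\<^sup>2"
    unfolding real_norm_def abs_mult by linarith
qed

lemma summable_sq_add:
  fixes x y :: "nat \<Rightarrow> real"
  assumes "summable (\<lambda>k. (x k)\<^sup>2)" "summable (\<lambda>k. (y k)\<^sup>2)"
  shows "summable (\<lambda>k. (x k + y k)\<^sup>2)"
proof -
  have "summable (\<lambda>k. (x k)\<^sup>2 + (y k)\<^sup>2 + 2 * (x k * y k))"
    by (intro summable_add summable_mult summable_prod_of_sq assms)
  then show ?thesis by (simp add: power2_sum mult.assoc)
qed

instantiation ell2 :: real_vector
begin

lift_definition zero_ell2 :: ell2 is "\<lambda>_. 0" by simp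

lift_definition plus_ell2 :: "ell2 \<Rightarrow> ell2 \<Rightarrow> ell2" is "\<lambda>x y k. x k + y k"
  by (rule summable_sq_add)

lift_definition uminus_ell2 :: "ell2 \<Rightarrow> ell2" is "\<lambda>x k. - x k" by simp

lift_definition minus_ell2 :: "ell2 \<Rightarrow> ell2 \<Rightarrow> ell2" is "\<lambda>x y k. x k - y k"
  subgoal for x y using summable_sq_add[of x "\<lambda>k. - y k"] by simp
  done

lift_definition scaleR_ell2 :: "real \<Rightarrow> ell2 \<Rightarrow> ell2" is "\<lambda>c x k. c * x k"
  by (simp add: power_mult_distrib summable_mult)

instance
  by standard (transfer; simp add: fun_eq_iff algebra_simps)+

end

instantiation ell2 :: real_inner
begin

definition inner_ell2 :: "ell2 \<Rightarrow> ell2 \<Rightarrow> real" where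
  "inner_ell2 x y = (\<Sum>k. coord x k * coord y k)"

definition norm_ell2 :: "ell2 \<Rightarrow> real" where
  "norm_ell2 x = sqrt (inner x x)"

definition dist_ell2 :: "ell2 \<Rightarrow> ell2 \<Rightarrow> real" where
  "dist_ell2 x y = norm (x - y)"

definition sgn_ell2 :: "ell2 \<Rightarrow> ell2" where
  "sgn_ell2 x = x /\<^sub>R norm x"

definition uniformity_ell2 :: "(ell2 \<times> ell2) filter" where
  "uniformity_ell2 = (INF e\<in>{0<..}. principal {(x, y). dist x y < e})"

definition open_ell2 :: "ell2 set \<Rightarrow> bool" where
  "open_ell2 U \<longleftrightarrow> (\<forall>x\<in>U. \<forall>\<^sub>F (x', y) in uniformity. x' = x \<longrightarrow> y \<in> U)"

instance
proof
  fix x y z :: ell2 and r :: real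
  have s: "summable (\<lambda>k. coord a k * coord b k)" for a b
    by (intro summable_prod_of_sq summable_coord_sq)
  show "inner x y = inner y x"
    by (simp add: inner_ell2_def mult.commute)
  show "inner (x + y) z = inner x z + inner y z"
    by (simp add: inner_ell2_def plus_ell2.rep_eq distrib_right suminf_add[OF s s])
  show "inner (r *\<^sub>R x) y = r * inner x y"
    by (simp add: inner_ell2_def scaleR_ell2.rep_eq mult.assoc suminf_mult[OF s])
  show "0 \<le> inner x x"
    unfolding inner_ell2_def by (intro suminf_nonneg s) simp
  show "inner x x = 0 \<longleftrightarrow> x = 0"
    unfolding inner_ell2_def
    by (subst suminf_eq_zero_iff[OF s])
      (auto simp: zero_ell2.rep_eq coord_inject[symmetric] fun_eq_iff)
qed (simp_all add: dist_ell2_def sgn_ell2_def uniformity_ell2_def open_ell2_def norm_ell2_def)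

end

text \<open>
  A sequence that is not square-summable is sent to \<open>0\<close>. A random sequence that is almost surely
  square-summable thereby becomes an \<open>ell2\<close>-valued map defined everywhere, whose law does not
  depend on the value chosen on the exceptional null set.
\<close>

definition to_ell2 :: "(nat \<Rightarrow> real) \<Rightarrow> ell2" where
  "to_ell2 x = (if summable (\<lambda>k. (x k)\<^sup>2) then Abs_ell2 x else 0)"

lemma coord_to_ell2: "summable (\<lambda>k. (x k)\<^sup>2) \<Longrightarrow> coord (to_ell2 x) = x"
  by (simp add: to_ell2_def Abs_ell2_inverse)

definition symmetric_stable_law :: "real \<Rightarrow> real measure \<Rightarrow> bool" where
  "symmetric_stable_law \<alpha> m \<longleftrightarrow>
     real_distribution m \<and> (\<forall>s. char m s = complex_of_real (exp (- (\<bar>s\<bar> powr \<alpha>))))"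

text \<open>The density is determined only up to Lebesgue-null sets; \<open>p\<close> is any real-valued version.\<close>

definition lborel_density_of :: "real measure \<Rightarrow> (real \<Rightarrow> real) \<Rightarrow> bool" where
  "lborel_density_of m p \<longleftrightarrow>
     p \<in> borel_measurable borel \<and> (\<forall>x. 0 \<le> p x) \<and> m = density lborel (\<lambda>x. ennreal (p x))"

definition equivalent_measures :: "'a measure \<Rightarrow> 'a measure \<Rightarrow> bool" where
  "equivalent_measures m n \<longleftrightarrow>
     sets m = sets n \<and> absolutely_continuous m n \<and> absolutely_continuous n m"

definition tendsto_in_L1 :: "'a measure \<Rightarrow> (nat \<Rightarrow> 'a \<Rightarrow> real) \<Rightarrow> ('a \<Rightarrow> real) \<Rightarrow> bool" where
  "tendsto_in_L1 m f g \<longleftrightarrow>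
     (\<forall>N. integrable m (f N)) \<and> integrable m g \<and>
     (\<lambda>N. \<integral>z. \<bar>f N z - g z\<bar> \<partial>m) \<longlonglongrightarrow> 0"

end

theory Submission
  imports Defs
begin

text \<open>
  A symmetric \<open>\<alpha>\<close>-stable law is a Gaussian scale mixture: it is the law of \<open>sqrt (2 * T) * Z\<close> with \<open>T\<close>
  positive \<open>\<alpha>/2\<close>-stable and \<open>Z\<close> standard normal. Hence \<open>p\<^sub>\<alpha> > 0\<close> almost everywhere, and joint concavity
  of the Hellinger affinity together with \<open>E[1/T] < \<infinity>\<close> gives
  \<open>\<integral> sqrt (p\<^sub>\<alpha> (x - a) * p\<^sub>\<alpha> x) dx \<ge> 1 - C * a\<^sup>2\<close>. By independence, for the partial likelihood ratios \<open>L\<^sub>N\<close>,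
  the expectation of \<open>sqrt (L\<^sub>n * L\<^sub>N)\<close> under \<open>\<nu>\<close> is a product of such affinities with \<open>a\<^sub>k = (u\<^sub>k - v\<^sub>k) / q\<^sub>k\<close>, so (as in
  Kakutani's theorem) \<open>\<Sum> a\<^sub>k\<^sup>2 < \<infinity>\<close> makes \<open>L\<^sub>N\<close> a Cauchy sequence in \<open>L\<^sup>1(\<nu>)\<close>. Its limit is a density of \<open>\<mu>\<close>,
  because \<open>L\<^sub>N\<close> reproduces \<open>\<mu>\<close> on sets depending on the first \<open>N\<close> coordinates and these generate the
  Borel sets of \<open>ell2\<close>. Equivalence follows by exchanging \<open>u\<close> and \<open>v\<close>.
\<close>

section \<open>Positive stable laws\<close>

lemma gbinomial_alternating_nonneg:
  fixes b :: real
  assumes "0 \<le> b" "b \<le> 1"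
  shows "0 \<le> (-1) ^ k * (b gchoose Suc k)"
proof (induction k)
  case 0
  then show ?case using assms by simp
next
  case (Suc k)
  have eq: "(b gchoose Suc (Suc k)) = (b gchoose Suc k) * ((b - Suc k) / (Suc (Suc k)))"
    using gbinomial_absorb_comp[of b "Suc k"] Suc_times_gbinomial[of "Suc k" "b - 1"]
      gbinomial_absorption[of "Suc k" b]
    by (simp add: field_simps)
  \<comment> \<open>Each further coefficient changes sign, since \<open>b \<le> 1\<close> makes
    \<open>b - Suc k\<close> nonpositive; the extra factor -1 compensates for this.\<close>
  have "(-1) ^ Suc k * (b gchoose Suc (Suc k))
      = ((-1) ^ k * (b gchoose Suc k)) * ((Suc k - b) / (Suc (Suc k)))"
    unfolding eq power_Suc by (simp add: diff_divide_distrib add_divide_distrib algebra_simps)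
  also have "\<dots> \<ge> 0"
    by (rule mult_nonneg_nonneg[OF Suc]) (use assms in auto)
  finally show ?case .
qed

text \<open>The Sibuya law: its weights are the signed binomial coefficients in the power series of
  \<open>1 - (1 - z) powr b\<close>, nonnegative by \<open>gbinomial_alternating_nonneg\<close>.
  Letting \<open>z\<close> increase to 1 shows that they add up to 1.\<close>

lemma sibuya_exists:
  fixes b :: real
  assumes b: "0 < b" "b \<le> 1"
  shows "\<exists>P::nat pmf. \<forall>z. 0 < z \<and> z < 1 \<longrightarrow>
    (\<integral>\<^sup>+k. ennreal (z ^ k) \<partial>measure_pmf P) = ennreal (1 - (1 - z) powr b)"
proof -
  define c :: "nat \<Rightarrow> real" where "c k = (if k = 0 then 0 else - ((-1) ^ k * (b gchoose k)))" for k
  have c0: "0 \<le> c k" for k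
    using gbinomial_alternating_nonneg[of b "k - 1"] b by (cases k) (auto simp: c_def)
  have S: "(\<lambda>k. c k * z ^ k) sums (1 - (1 - z) powr b)" if "0 < z" "z < 1" for z
  proof -
    have "(\<lambda>k. (b gchoose k) * (-z)^k) sums (1 + - z) powr b"
      by (rule gen_binomial_real) (use that in auto)
    then have "(\<lambda>k. (if k = 0 then 1 else 0) - (b gchoose k) * (-z)^k) sums (1 - (1 + - z) powr b)"
      using sums_single[of 0 "\<lambda>_. 1::real"] by (intro sums_diff) auto
    moreover have "(if k = 0 then 1 else 0) - (b gchoose k) * (-z)^k = c k * z ^ k" for k
      by (auto simp: c_def power_minus[of z])
    ultimately show ?thesis by simp
  qed
  \<comment> \<open>For \<open>z\<close> below 1 a partial sum is at most the whole series, hence at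
    most 1; the limit \<open>z\<close> to 1 removes the powers of \<open>z\<close>.\<close>
  have fin: "sum c {..<n} \<le> 1" for n
  proof (rule tendsto_le)
    show "((\<lambda>z. \<Sum>k<n. c k * z ^ k) \<longlongrightarrow> sum c {..<n}) (at_left 1)"
      by (auto intro!: tendsto_eq_intros sum.cong)
    show "((\<lambda>_. 1::real) \<longlongrightarrow> 1) (at_left (1::real))" by simp
    have "\<forall>\<^sub>F z in at_left (1::real). z \<in> {0<..<1}"
      by (rule eventually_at_left_real) simp
    then show "\<forall>\<^sub>F z in at_left 1. (\<Sum>k<n. c k * z ^ k) \<le> 1"
    proof eventually_elim
      case (elim z)
      then have "(\<Sum>k<n. c k * z ^ k) \<le> 1 - (1 - z) powr b"
        using S[of z] c0 sum_le_suminf[of "\<lambda>k. c k * z ^ k" "{..<n}"]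
        by (auto simp: sums_iff)
      then show ?case
        by (smt (verit) powr_ge_zero)
    qed
  qed simp
  have sm: "summable c"
    by (rule summableI_nonneg_bounded[OF c0 fin])
  \<comment> \<open>Conversely, \<open>suminf c\<close> dominates the series at every
    \<open>z\<close> below 1, whose value tends to 1 because \<open>b > 0\<close>.\<close>
  have "suminf c \<ge> 1"
  proof (rule tendsto_le)
    show "((\<lambda>z. 1 - (1 - z) powr b) \<longlongrightarrow> 1) (at_left (1::real))"
      using b by (auto intro!: tendsto_eq_intros simp: eventually_at_filter)
    show "((\<lambda>_. suminf c) \<longlongrightarrow> suminf c) (at_left (1::real))" by simp
    have "\<forall>\<^sub>F z in at_left (1::real). z \<in> {0<..<1}"
      by (rule eventually_at_left_real) simp
    then show "\<forall>\<^sub>F z in at_left 1. 1 - (1 - z) powr b \<le> suminf c"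
    proof eventually_elim
      case (elim z)
      then have "c k * z ^ k \<le> c k" for k
        using c0[of k] by (auto intro!: mult_left_le power_le_one)
      with elim S[of z] sm show ?case
        by (metis greaterThanLessThan_iff sums_le summable_sums)
    qed
  qed simp
  moreover have "suminf c \<le> 1"
    by (rule suminf_le_const[OF sm fin])
  ultimately have one: "(\<integral>\<^sup>+k. ennreal (c k) \<partial>count_space UNIV) = 1"
    using c0 sm by (simp add: nn_integral_count_space_nat suminf_ennreal2)
  have pm: "pmf (embed_pmf c) k = c k" for k
    by (rule pmf_embed_pmf[OF c0 one])
  show ?thesis
  proof (intro exI[of _ "embed_pmf c"] allI impI)
    fix z :: real assume z: "0 < z \<and> z < 1"
    have "(\<integral>\<^sup>+k. ennreal (z ^ k) \<partial>measure_pmf (embed_pmf c)) = (\<Sum>k. ennreal (c k * z ^ k))"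
      using z c0 by (simp add: nn_integral_measure_pmf pm nn_integral_count_space_nat ennreal_mult)
    also have "\<dots> = ennreal (1 - (1 - z) powr b)"
      using z c0 S[of z] by (subst suminf_ennreal2) (auto simp: sums_iff)
    finally show "(\<integral>\<^sup>+k. ennreal (z ^ k) \<partial>measure_pmf (embed_pmf c)) = \<dots>" .
  qed
qed

text \<open>\<open>Q\<close> is the law of the sum of \<open>n\<close> independent variables with
  law \<open>P\<close>; generating functions multiply under independent addition.\<close>

lemma iterated_sum_pmf_exists:
  fixes P :: "nat pmf"
  shows "\<exists>Q::nat pmf. \<forall>z. 0 \<le> z \<longrightarrow>
    (\<integral>\<^sup>+k. ennreal (z ^ k) \<partial>measure_pmf Q) = (\<integral>\<^sup>+k. ennreal (z ^ k) \<partial>measure_pmf P) ^ n"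
proof (induction n)
  case 0
  show ?case by (intro exI[of _ "return_pmf 0"]) simp
next
  case (Suc n)
  then obtain Q :: "nat pmf" where Q: "\<And>z. 0 \<le> z \<Longrightarrow>
    (\<integral>\<^sup>+k. ennreal (z ^ k) \<partial>measure_pmf Q) = (\<integral>\<^sup>+k. ennreal (z ^ k) \<partial>measure_pmf P) ^ n"
    by blast
  show ?case
    by (intro exI[of _ "map_pmf (\<lambda>(i, j). i + j) (pair_pmf P Q)"])
      (auto simp: nn_integral_pair_pmf' Q[symmetric] power_add ennreal_mult nn_integral_cmult nn_integral_multc)
qed

text \<open>The base is the Sibuya generating function at \<open>exp (- s * h)\<close> with
  \<open>h = real n powr (- 1 / b)\<close>, so the power is the Laplace transform of a scaled
  \<open>n\<close>-fold sum. As \<open>(1 - exp (- s * h)) / h\<close> tends to \<open>s\<close>,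
  the base is \<open>1 - y n / n\<close> with \<open>y n\<close> tending to
  \<open>s powr b\<close>.\<close>

lemma sibuya_scaling_limit:
  fixes b s :: real
  assumes b: "0 < b" "b \<le> 1" and s: "0 < s"
  shows "(\<lambda>n. (1 - (1 - exp (- s * real n powr (- 1 / b))) powr b) ^ n) \<longlonglongrightarrow> exp (- (s powr b))"
proof -
  define y where "y n = real n * (1 - exp (- s * real n powr (- 1 / b))) powr b" for n :: nat
  have n0: "(\<lambda>n. real n powr (- 1 / b)) \<longlonglongrightarrow> 0"
    using b by (intro tendsto_neg_powr filterlim_real_sequentially) auto
  have "((\<lambda>h. (1 - exp (- s * h)) / h) \<longlongrightarrow> s) (at_right 0)"
  proof -
    have "((\<lambda>h. 1 - exp (- s * h)) has_real_derivative s) (at 0)"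
      by (auto intro!: derivative_eq_intros)
    then show ?thesis
      by (auto simp: has_field_derivative_iff intro: tendsto_within_subset filterlim_mono at_le)
  qed
  moreover have "filterlim (\<lambda>n. real n powr (- 1 / b)) (at_right 0) sequentially"
    unfolding filterlim_at using n0 
    by (auto intro: eventually_mono[OF eventually_gt_at_top[of 0]])
  ultimately have "(\<lambda>n. (1 - exp (- s * real n powr (- 1 / b))) / real n powr (- 1 / b)) \<longlonglongrightarrow> s"
    by (rule filterlim_compose)
  then have "(\<lambda>n. ((1 - exp (- s * real n powr (- 1 / b))) / real n powr (- 1 / b)) powr b) \<longlonglongrightarrow> s powr b"
    using s by (intro tendsto_intros) auto
  moreover have "\<forall>\<^sub>F n in sequentially.
    ((1 - exp (- s * real n powr (- 1 / b))) / real n powr (- 1 / b)) powr b = y n"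
    using eventually_gt_at_top[of 0]
  proof eventually_elim
    case (elim n)
    have "(w / real n powr (- 1 / b)) powr b = real n * w powr b" if "0 \<le> w" for w
      using that elim b by (simp add: powr_divide powr_powr powr_minus_divide powr_mult)
    then show ?case
      using s by (simp add: y_def)
  qed
  ultimately have y: "y \<longlonglongrightarrow> s powr b"
    by (rule Lim_transform_eventually)
  then have "(\<lambda>n. (1 + (- y n) / n) ^ n) \<longlonglongrightarrow> exp (- (s powr b))"
  proof -
    define l where "l = s powr b"
    have l: "0 < l" using s by (simp add: l_def)
    \<comment> \<open>The limit \<open>l\<close> may replace \<open>y n\<close>: on numbers of
      modulus at most 1 the \<open>n\<close>-th power is Lipschitz with constant \<open>n\<close>,
      and the two bases differ by \<open>\<bar>y n - l\<bar> / n\<close>.\<close>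
    have "(\<lambda>n. (1 + (- y n) / n) ^ n - (1 + (- l) / n) ^ n) \<longlonglongrightarrow> 0"
    proof (rule Lim_null_comparison)
      show "(\<lambda>n. \<bar>y n - l\<bar>) \<longlonglongrightarrow> 0"
        using y by (simp add: l_def tendsto_rabs_zero LIM_zero)
      have "\<forall>\<^sub>F n in sequentially. y n < l + 1"
        using y by (rule order_tendstoD) (simp add: l_def)
      moreover have "\<forall>\<^sub>F n in sequentially. l + 1 < real n"
        using filterlim_real_sequentially by (simp add: filterlim_at_top_dense)
      ultimately show "\<forall>\<^sub>F n in sequentially.
        norm ((1 + (- y n) / n) ^ n - (1 + (- l) / n) ^ n) \<le> \<bar>y n - l\<bar>"
      proof eventually_elim
        case (elim n)
        have y0: "0 \<le> y n" by (simp add: y_def)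
        have "norm ((1 + (- y n) / n) ^ n - (1 + (- l) / n) ^ n)
            \<le> n * norm ((1 + (- y n) / n) - (1 + (- l) / n))"
          using elim y0 l by (intro norm_power_diff) (auto simp: abs_le_iff field_simps)
        also have "\<dots> = \<bar>y n - l\<bar>"
          using elim l by (simp add: diff_divide_distrib[symmetric] abs_minus_commute)
        finally show ?case .
      qed
    qed
    from tendsto_add[OF this tendsto_exp_limit_sequentially[of "- l"]] show ?thesis
      by (simp add: l_def)
  qed
  moreover have "\<forall>\<^sub>F n in sequentially. (1 + (- y n) / n) ^ n
     = (1 - (1 - exp (- s * real n powr (- 1 / b))) powr b) ^ n"
    using eventually_gt_at_top[of 0] by eventually_elim (simp add: y_def)
  ultimately show ?thesis
    by (rule Lim_transform_eventually)
qed


text \<open>The weak limit, along a subsequence, of \<open>n\<close>-fold sums of Sibuya variables scaled by \<open>n powr (-1/b)\<close>.\<close>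

lemma positive_stable_exists:
  fixes b :: real
  assumes b: "0 < b" "b \<le> 1"
  shows "\<exists>S. real_distribution S \<and> (AE t in S. 0 < t) \<and>
    (\<forall>s>0. (\<integral>\<^sup>+t. ennreal (exp (- s * t)) \<partial>S) = ennreal (exp (- (s powr b))))"
proof -
  obtain P :: "nat pmf" where P: "\<And>z. 0 < z \<Longrightarrow> z < 1 \<Longrightarrow>
      (\<integral>\<^sup>+k. ennreal (z ^ k) \<partial>measure_pmf P) = ennreal (1 - (1 - z) powr b)"
    using sibuya_exists[OF b] by blast
  obtain Q :: "nat \<Rightarrow> nat pmf" where Q: "\<And>n z. 0 \<le> z \<Longrightarrow>
      (\<integral>\<^sup>+k. ennreal (z ^ k) \<partial>measure_pmf (Q n)) = (\<integral>\<^sup>+k. ennreal (z ^ k) \<partial>measure_pmf P) ^ n"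
    using iterated_sum_pmf_exists[of P] by metis
  \<comment> \<open>The index \<open>Suc n\<close> avoids \<open>n = 0\<close>, where the scaling
    factor \<open>0 powr (- 1 / b)\<close> would be 0.\<close>
  define \<mu> where "\<mu> n = distr (measure_pmf (Q (Suc n))) borel (\<lambda>k. real k * real (Suc n) powr (- 1 / b))"
    for n
  define L where "L n s = (1 - (1 - exp (- s * real (Suc n) powr (- 1 / b))) powr b) ^ Suc n" for n s
  have rd: "real_distribution (\<mu> n)" for n
    unfolding \<mu>_def by (intro prob_space.real_distribution_distr prob_space_measure_pmf) simp
  have nneg: "AE t in \<mu> n. 0 \<le> t" for n
    unfolding \<mu>_def by (subst AE_distr_iff) auto
  have lap: "(\<integral>\<^sup>+t. ennreal (exp (- s * t)) \<partial>\<mu> n) = ennreal (L n s)" if s: "0 < s" for n s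
  proof -
    define z where "z = exp (- s * real (Suc n) powr (- 1 / b))"
    have z: "0 < z" "z < 1" using s by (auto simp: z_def)
    have "(\<integral>\<^sup>+t. ennreal (exp (- s * t)) \<partial>\<mu> n) = (\<integral>\<^sup>+k. ennreal (z ^ k) \<partial>measure_pmf (Q (Suc n)))"
      unfolding \<mu>_def z_def
      by (subst nn_integral_distr) (auto simp: exp_of_nat_mult[symmetric] algebra_simps intro!: nn_integral_cong)
    also have "\<dots> = ennreal (1 - (1 - z) powr b) ^ Suc n"
      using z by (simp add: Q P)
    also have "\<dots> = ennreal ((1 - (1 - z) powr b) ^ Suc n)"
      using z b by (intro ennreal_power) (auto intro!: powr_le1)
    finally show ?thesis by (simp add: L_def z_def)
  qed
  have Llim: "(\<lambda>n. L n s) \<longlonglongrightarrow> exp (- (s powr b))" if s: "0 < s" for s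
    unfolding L_def using LIMSEQ_Suc[OF sibuya_scaling_limit[OF b s]] by simp
  have L01: "0 \<le> L n s" "L n s \<le> 1" if "0 < s" for n s
  proof -
    have "(1 - exp (- s * real (Suc n) powr (- 1 / b))) powr b \<le> 1"
      using that b by (intro powr_le1) auto
    then show "0 \<le> L n s" "L n s \<le> 1"
      unfolding L_def by (auto intro!: power_le_one zero_le_power simp del: power_Suc)
  qed
  \<comment> \<open>Weak convergence asks for bounded continuous test functions on the whole line.
    Cutting \<open>t\<close> off at 0 provides one for every \<open>s > 0\<close>, equal to the
    Laplace kernel on the nonnegative half-line that carries the laws.\<close>
  define h where "h s t = exp (- s * max t 0)" for s t :: real
  have h_meas [measurable]: "h s \<in> borel_measurable borel" for s
    unfolding h_def[abs_def] by measurable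
  have [measurable_cong]: "sets (\<mu> n) = sets borel" for n by (simp add: \<mu>_def)
  have h_cont: "isCont (h s) t" for s t
    unfolding h_def[abs_def] by (intro continuous_intros)
  have h_lap: "integral\<^sup>L (\<mu> n) (h s) = L n s" if s: "0 < s" for n s
  proof -
    have "(\<integral>\<^sup>+t. ennreal (h s t) \<partial>\<mu> n) = (\<integral>\<^sup>+t. ennreal (exp (- s * t)) \<partial>\<mu> n)"
      by (intro nn_integral_cong_AE) (use nneg[of n] in eventually_elim, simp add: h_def)
    then show ?thesis
      using lap[OF s, of n] L01[OF s]
      by (subst integral_eq_nn_integral) (measurable, auto simp: h_def)
  qed
  \<comment> \<open>Tails are controlled by the Laplace transform near 0: beyond \<open>K\<close>
    the kernel \<open>h (1 / K)\<close> is at most \<open>exp (-1) \<le> 1 / 2\<close>, so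
    \<open>2 * (1 - h (1 / K) t)\<close> dominates the indicator.\<close>
  have tail: "measure (\<mu> n) {K<..} \<le> 2 * (1 - L n (1 / K))" if K: "0 < K" for n K
  proof -
    interpret real_distribution "\<mu> n" by (rule rd)
    have h1: "h (1 / K) t \<le> 1" for t using K by (simp add: h_def)
    have "measure (\<mu> n) {K<..} = (\<integral>t. indicator {K<..} t \<partial>\<mu> n)"
      by simp
    also have "\<dots> \<le> (\<integral>t. 2 * (1 - h (1 / K) t) \<partial>\<mu> n)"
    proof (rule integral_mono)
      have i: "integrable (\<mu> n) (h (1 / K))"
        using K by (intro integrable_const_bound[where B=1]) (auto simp: h_def)
      then show "integrable (\<mu> n) (\<lambda>t. 2 * (1 - h (1 / K) t))" by simp
      fix t
      have "h (1 / K) t \<le> 1 / 2" if "K < t"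
      proof -
        have "h (1 / K) t \<le> exp (-1)" using that K by (simp add: h_def max_def)
        also have "\<dots> \<le> 1 / (2::real)"
          using exp_ge_add_one_self[of 1] by (simp add: exp_minus field_simps)
        finally show ?thesis .
      qed
      then show "indicator {K<..} t \<le> 2 * (1 - h (1 / K) t)"
        using h1[of t] by (auto simp: indicator_def)
    qed (intro integrable_const_bound[where B=1], auto)
    also have "\<dots> = 2 * (1 - L n (1 / K))"
    proof -
      have i: "integrable (\<mu> n) (h (1 / K))"
        using K by (intro integrable_const_bound[where B=1]) (auto simp: h_def)
      show ?thesis using K h_lap[of "1 / K" n] i by (simp add: prob_space[unfolded space_eq_univ])
    qed
    finally show ?thesis .
  qed
  have "tight \<mu>"
    unfolding tight_def
  proof (intro conjI allI impI rd)
    fix e :: real assume e: "0 < e"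
    \<comment> \<open>The limiting Laplace transform is continuous at 0 with value 1. This yields a
      \<open>K0\<close> that serves all but finitely many indices.\<close>
    have "((\<lambda>K. exp (- ((1 / K) powr b))) \<longlongrightarrow> exp (- (0 powr b))) at_top"
      using b by (intro tendsto_intros tendsto_powr' real_tendsto_divide_at_top filterlim_ident) auto
    then have "\<forall>\<^sub>F K in at_top. 1 - e / 2 < exp (- ((1 / K) powr b))"
      using e by (intro order_tendstoD) auto
    moreover have "\<forall>\<^sub>F K in at_top. 0 < (K::real)" by (rule eventually_gt_at_top)
    ultimately have "\<forall>\<^sub>F K in at_top. 0 < (K::real) \<and> 1 - e / 2 < exp (- ((1 / K) powr b))"
      by eventually_elim auto
    then obtain K0 :: real where K0: "0 < K0" "1 - e / 2 < exp (- ((1 / K0) powr b))"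
      by (auto dest: eventually_happens)
    have ev: "\<forall>\<^sub>F n in sequentially. measure (\<mu> n) {-1<..K0} > 1 - e"
    proof -
      have "\<forall>\<^sub>F n in sequentially. 1 - e / 2 < L n (1 / K0)"
        using K0 by (intro order_tendstoD(1)[OF Llim]) auto
      then show ?thesis
      proof eventually_elim
        case (elim n)
        interpret real_distribution "\<mu> n" by (rule rd)
        have "AE t in \<mu> n. (t \<in> {-1<..K0}) = (t \<notin> {K0<..})"
          using nneg[of n] by eventually_elim auto
        then have "prob {-1<..K0} = prob (UNIV - {K0<..})"
          by (intro finite_measure_eq_AE) auto
        also have "\<dots> = 1 - prob {K0<..}"
          using prob_compl[of "{K0<..}"] by simp
        finally show ?case using tail[OF K0(1), of n] elim by simp
      qed
    qed
    then obtain N where N: "\<And>n. N \<le> n \<Longrightarrow> measure (\<mu> n) {-1<..K0} > 1 - e"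
      by (auto simp: eventually_sequentially)
    have "\<exists>K. K0 \<le> K \<and> measure (\<mu> n) {-1<..K} > 1 - e" for n
    proof -
      interpret real_distribution "\<mu> n" by (rule rd)
      have "(\<lambda>k. prob {-1<..real k}) \<longlonglongrightarrow> prob (\<Union>k. {-1<..real k})"
        by (intro finite_Lim_measure_incseq) (auto simp: incseq_def)
      moreover have "prob (\<Union>k. {-1<..real k}) = 1"
      proof -
        have "prob (\<Union>k. {-1<..real k}) = prob UNIV"
          using nneg[of n] real_arch_simple by (intro finite_measure_eq_AE) (auto elim!: eventually_mono)
        then show ?thesis using prob_space by simp
      qed
      ultimately have "\<forall>\<^sub>F k in sequentially. 1 - e < prob {-1<..real k}"
        using e by (intro order_tendstoD(1)) auto
      moreover have "\<forall>\<^sub>F k in sequentially. K0 \<le> real k"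
        using filterlim_real_sequentially by (simp add: filterlim_at_top)
      ultimately have "\<forall>\<^sub>F k in sequentially. K0 \<le> real k \<and> 1 - e < prob {-1<..real k}"
        by eventually_elim auto
      then show ?thesis
        by (auto dest: eventually_happens)
    qed
    then obtain K where K: "\<And>n. K0 \<le> K n" "\<And>n. measure (\<mu> n) {-1<..K n} > 1 - e"
      by metis
    \<comment> \<open>All summands are positive, so the sum bounds \<open>K0\<close> and each of the
      finitely many \<open>K n\<close> with \<open>n < N\<close>.\<close>
    define B where "B = K0 + (\<Sum>n<N. K n)"
    have KB: "K n \<le> B" if "n < N" for n
      using that K0(1) K(1) member_le_sum[of n "{..<N}" K] order_trans[OF less_imp_le[OF K0(1)] K(1)]
      by (simp add: B_def)
    have K0B: "K0 \<le> B"
      using order_trans[OF less_imp_le[OF K0(1)] K(1)] by (auto simp: B_def intro!: sum_nonneg)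
    show "\<exists>a c. a < c \<and> (\<forall>n. 1 - e < measure (\<mu> n) {a<..c})"
    proof (rule exI[of _ "-1"], rule exI[of _ B], intro conjI allI)
      show "- 1 < B" using K0 K0B by linarith
      fix n
      interpret real_distribution "\<mu> n" by (rule rd)
      define c where "c = (if n < N then K n else K0)"
      have "1 - e < prob {-1<..c}" using K(2)[of n] N[of n] by (simp add: c_def)
      also have "\<dots> \<le> prob {-1<..B}"
        using KB[of n] K0B by (intro finite_measure_mono) (auto simp: c_def split: if_splits)
      finally show "1 - e < prob {-1<..B}" .
    qed
  qed
  from tight_imp_convergent_subsubsequence[OF this strict_mono_id]
  obtain r S where r: "strict_mono r" and S: "real_distribution S" and wc: "weak_conv_m (\<mu> \<circ> r) S"
    by auto
  interpret S: real_distribution S by fact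
  have rdr: "real_distribution ((\<mu> \<circ> r) n)" for n using rd by simp
  have hS: "integral\<^sup>L S (h s) = exp (- (s powr b))" if s: "0 < s" for s
  proof (rule LIMSEQ_unique)
    show "(\<lambda>n. integral\<^sup>L ((\<mu> \<circ> r) n) (h s)) \<longlonglongrightarrow> integral\<^sup>L S (h s)"
      using s by (intro weak_conv_imp_integral_bdd_continuous_conv[OF rdr S wc, where B=1])
        (auto simp: h_cont, auto simp: h_def)
    show "(\<lambda>n. integral\<^sup>L ((\<mu> \<circ> r) n) (h s)) \<longlonglongrightarrow> exp (- (s powr b))"
      using LIMSEQ_subseq_LIMSEQ[OF Llim[OF s] r] by (simp add: h_lap[OF s] comp_def)
  qed
  have Snn: "AE t in S. 0 \<le> t"
  proof -
    \<comment> \<open>A bounded continuous function that is zero exactly on the nonnegative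
      half-line: its integrals vanish along the sequence, hence also in the limit.\<close>
    define g :: "real \<Rightarrow> real" where "g t = min 1 (max (- t) 0)" for t
    have g_meas [measurable]: "g \<in> borel_measurable borel"
      unfolding g_def[abs_def] by measurable
    have "isCont g t" for t
      unfolding g_def[abs_def] by (intro continuous_intros)
    then have "(\<lambda>n. integral\<^sup>L ((\<mu> \<circ> r) n) g) \<longlonglongrightarrow> integral\<^sup>L S g"
      by (intro weak_conv_imp_integral_bdd_continuous_conv[OF rdr S wc, where B=1])
        (auto, auto simp: g_def)
    moreover have "integral\<^sup>L ((\<mu> \<circ> r) n) g = 0" for n
    proof -
      interpret real_distribution "\<mu> (r n)" by (rule rd)
      have "integral\<^sup>L (\<mu> (r n)) g = integral\<^sup>L (\<mu> (r n)) (\<lambda>_. 0)"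
        by (intro integral_cong_AE, measurable, use nneg[of "r n"] in eventually_elim) (simp add: g_def)
      then show ?thesis by simp
    qed
    ultimately have "integral\<^sup>L S g = 0" by (simp add: LIMSEQ_const_iff)
    moreover have "integrable S g"
      by (intro S.integrable_const_bound[where B=1]) (auto, auto simp: g_def)
    ultimately have "AE t in S. g t = 0"
      by (subst (asm) integral_nonneg_eq_0_iff_AE) (auto simp: g_def)
    then show ?thesis by eventually_elim (auto simp: g_def min_def max_def split: if_splits)
  qed
  have pos: "AE t in S. 0 < t"
  proof -
    \<comment> \<open>An atom at 0 is excluded by letting \<open>s\<close> grow: \<open>h s\<close>
      is 1 on \<open>{..0}\<close>, while its integral tends to 0.\<close>
    have le: "S.prob {..0} \<le> exp (- (s powr b))" if s: "0 < s" for s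
    proof -
      have "S.prob {..0} = (\<integral>t. indicator {..0} t \<partial>S)" by simp
      also have "\<dots> \<le> integral\<^sup>L S (h s)"
        using s by (intro integral_mono S.integrable_const_bound[where B=1])
          (auto simp: h_def indicator_def)
      finally show ?thesis using hS[OF s] by simp
    qed
    have le': "S.prob {..0} \<le> s powr (- b)" if s: "0 < s" for s
    proof -
      have "s powr b \<le> exp (s powr b)"
        using exp_ge_add_one_self[of "s powr b"] by linarith
      then have "exp (- (s powr b)) \<le> s powr (- b)"
        using s by (simp add: exp_minus powr_minus le_imp_inverse_le)
      with le[OF s] show ?thesis by linarith
    qed
    have "((\<lambda>s. s powr (- b)) \<longlongrightarrow> 0) at_top"
      using b by (intro tendsto_neg_powr filterlim_ident) auto
    then have "S.prob {..0} \<le> 0"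
      by (rule tendsto_lowerbound) (auto intro: eventually_mono[OF eventually_gt_at_top[of 0]] le')
    then have "S.prob {..0} = 0" by (simp add: measure_le_0_iff)
    then have "AE t in S. t \<notin> {..0}"
      by (subst (asm) S.prob_eq_0) auto
    then show ?thesis by eventually_elim auto
  qed
  show ?thesis
  proof (intro exI[of _ S] conjI allI impI S pos)
    fix s :: real assume s: "0 < s"
    have "(\<integral>\<^sup>+t. ennreal (exp (- s * t)) \<partial>S) = (\<integral>\<^sup>+t. ennreal (h s t) \<partial>S)"
      by (intro nn_integral_cong_AE) (use Snn in eventually_elim, simp add: h_def)
    also have "\<dots> = ennreal (integral\<^sup>L S (h s))"
      using s by (intro nn_integral_eq_integral S.integrable_const_bound[where B=1]) (auto simp: h_def)
    finally show "(\<integral>\<^sup>+t. ennreal (exp (- s * t)) \<partial>S) = ennreal (exp (- (s powr b)))"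
      by (simp add: hS[OF s])
  qed
qed

section \<open>Gaussian mixtures and Hellinger affinity\<close>

text \<open>Density of \<open>N(0, 2 * t)\<close>; mixing measures charge only \<open>t > 0\<close>, so the values at \<open>t \<le> 0\<close> do not matter.\<close>

definition gauss_kernel :: "real \<Rightarrow> real \<Rightarrow> real" where
  "gauss_kernel t x = exp (- (x\<^sup>2 / (4 * t))) / sqrt (4 * pi * t)"

lemma gauss_kernel_measurable [measurable (raw)]:
  assumes [measurable]: "f \<in> borel_measurable M" "g \<in> borel_measurable M"
  shows "(\<lambda>x. gauss_kernel (f x) (g x)) \<in> borel_measurable M"
  unfolding gauss_kernel_def by measurable

lemma gauss_kernel_pos: "0 < t \<Longrightarrow> 0 < gauss_kernel t x"
  by (simp add: gauss_kernel_def)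

lemma gauss_kernel_eq_normal_density:
  "0 < t \<Longrightarrow> gauss_kernel t x = normal_density 0 (sqrt (2 * t)) x"
  by (simp add: gauss_kernel_def normal_density_def mult.assoc)

lemma nn_integral_gauss_kernel:
  assumes t: "0 < t"
  shows "(\<integral>\<^sup>+x. ennreal (gauss_kernel t (x + c)) \<partial>lborel) = 1"
proof -
  have "(\<integral>\<^sup>+x. ennreal (gauss_kernel t x) \<partial>lborel) = 1"
    using t by (simp add: gauss_kernel_eq_normal_density nn_integral_eq_integral)
  then show ?thesis
    by (subst (asm) nn_integral_real_affine[where t=c and c=1]) (auto simp: add.commute)
qed

text \<open>Completing the square: \<open>(x - a)\<^sup>2 + x\<^sup>2 = 2 * (x - a / 2)\<^sup>2 +
  a\<^sup>2 / 2\<close>. The exponential factor is therefore the Hellinger affinity of the normal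
  law and its translate by \<open>a\<close>.\<close>

lemma gauss_kernel_geometric_mean:
  assumes t: "0 < t"
  shows "sqrt (gauss_kernel t (x - a) * gauss_kernel t x)
    = exp (- (a\<^sup>2 / (16 * t))) * gauss_kernel t (x - a / 2)"
proof -
  have e: "exp (- ((x - a)\<^sup>2 / (4 * t))) * exp (- (x\<^sup>2 / (4 * t)))
    = (exp (- (a\<^sup>2 / (16 * t))) * exp (- ((x - a / 2)\<^sup>2 / (4 * t))))\<^sup>2"
    using t by (simp add: power_mult_distrib exp_double[symmetric] mult_exp_exp field_simps power2_eq_square)
  have "gauss_kernel t (x - a) * gauss_kernel t x
     = (exp (- (a\<^sup>2 / (16 * t))) * gauss_kernel t (x - a / 2))\<^sup>2"
    using t e by (simp add: gauss_kernel_def power_mult_distrib power_divide power2_eq_square)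
  then show ?thesis
    using gauss_kernel_pos[OF t, of "x - a / 2"] by (simp add: real_sqrt_mult)
qed

text \<open>Mixing centred normal laws of variance \<open>2 * t\<close> over \<open>S\<close>
  produces the symmetric stable law of index \<open>2 * b\<close>, which is why \<open>b\<close> is
  later \<open>\<alpha> / 2\<close>.\<close>

locale positive_stable = real_distribution S for S +
  fixes b :: real
  assumes b: "0 < b" "b \<le> 1"
    and pos: "AE t in S. 0 < t"
    and laplace: "0 < s \<Longrightarrow> (\<integral>\<^sup>+t. ennreal (exp (- s * t)) \<partial>S) = ennreal (exp (- (s powr b)))"
begin

text \<open>\<open>1/t\<close> is the integral of \<open>exp (- s * t)\<close> over \<open>s > 0\<close>, so its expectation is read off the Laplace transform.\<close>

lemma nn_integral_inverse_finite: "(\<integral>\<^sup>+t. ennreal (1 / t) \<partial>S) < \<infinity>"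
proof -
  interpret P: pair_sigma_finite lborel S
    unfolding pair_sigma_finite_def using sigma_finite_measure_axioms sigma_finite_lborel by blast
  have inv: "(\<integral>\<^sup>+s. ennreal (exp (- s * t)) * indicator {0<..} s \<partial>lborel) = ennreal (1 / t)"
    if t: "0 < t" for t
  proof -
    have "(\<integral>\<^sup>+s. ennreal (exp (- s * t)) * indicator {0..} s \<partial>lborel) = ennreal (0 - (- exp (- 0 * t) / t))"
    proof (rule nn_integral_FTC_atLeast)
      have "((\<lambda>s. - (exp (- (s * t))) / t) \<longlongrightarrow> - 0 / t) at_top"
        using t by (intro tendsto_intros filterlim_compose[OF exp_at_bot]
            filterlim_compose[OF filterlim_uminus_at_bot_at_top] filterlim_at_top_mult_tendsto_pos[OF tendsto_const] filterlim_ident) auto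
      then show "((\<lambda>s. - exp (- s * t) / t) \<longlongrightarrow> 0) at_top" by simp
    qed (use t in \<open>auto intro!: derivative_eq_intros\<close>)
    moreover have "(\<integral>\<^sup>+s. ennreal (exp (- s * t)) * indicator {0<..} s \<partial>lborel)
        = (\<integral>\<^sup>+s. ennreal (exp (- s * t)) * indicator {0..} s \<partial>lborel)"
      by (intro nn_integral_cong_AE, use AE_lborel_singleton[of 0] in eventually_elim)
        (auto simp: indicator_def)
    ultimately show ?thesis by simp
  qed
  have "(\<integral>\<^sup>+t. ennreal (1 / t) \<partial>S) = (\<integral>\<^sup>+t. \<integral>\<^sup>+s. ennreal (exp (- s * t)) * indicator {0<..} s \<partial>lborel \<partial>S)"
    by (intro nn_integral_cong_AE, use pos in eventually_elim) (rule inv[symmetric])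
  also have "\<dots> = (\<integral>\<^sup>+s. \<integral>\<^sup>+t. ennreal (exp (- s * t)) * indicator {0<..} s \<partial>S \<partial>lborel)"
    by (rule P.Fubini') measurable
  also have "\<dots> = (\<integral>\<^sup>+s. ennreal (exp (- (s powr b))) * indicator {0<..} s \<partial>lborel)"
    by (intro nn_integral_cong) (auto simp: indicator_def laplace[simplified])
  also have "\<dots> < \<infinity>"
  proof -
    \<comment> \<open>With \<open>b * k \<ge> 2\<close>, the \<open>k\<close>-th power of
      \<open>s powr b\<close> dominates \<open>s powr 2\<close> for \<open>s \<ge> 1\<close>, so the
      integrand has an integrable tail.\<close>
    define k where "k = nat \<lceil>2 / b\<rceil>"
    have "2 / b \<le> k" unfolding k_def by (rule real_nat_ceiling_ge)
    then have k: "2 \<le> b * k"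
      using b by (simp add: field_simps)
    have kpos: "0 < k" using k by (cases "k = 0") auto
    have bnd: "exp (- (s powr b)) \<le> real k ^ k * s powr (-2)" if s: "1 \<le> s" for s
    proof -
      have "s powr 2 \<le> s powr (b * k)" using s k by (intro powr_mono) auto
      also have "\<dots> = (s powr b) ^ k" using s by (simp add: powr_powr[symmetric] powr_realpow)
      \<comment> \<open>This is \<open>(1 + x / k) ^ k \<le> exp x\<close> at
        \<open>x = s powr b\<close>, the source of the constant \<open>real k ^ k\<close>.\<close>
      also have "\<dots> \<le> real k ^ k * exp (s powr b)"
      proof -
        have "(s powr b / k) ^ k \<le> (1 + s powr b / k) ^ k"
          by (intro power_mono) auto
        also have "\<dots> \<le> exp (s powr b)"
          using kpos by (intro exp_ge_one_plus_x_over_n_power_n) (auto intro: order_trans[of _ 0])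
        finally show ?thesis using kpos by (simp add: power_divide field_simps)
      qed
      finally show ?thesis using s by (simp add: exp_minus powr_minus field_simps)
    qed
    have "(\<integral>\<^sup>+s. ennreal (exp (- (s powr b))) * indicator {0<..} s \<partial>lborel)
      \<le> (\<integral>\<^sup>+s. indicator {0..1} s + ennreal (real k ^ k * s powr (-2)) * indicator {1..} s \<partial>lborel)"
    proof (intro nn_integral_mono)
      fix s :: real
      have "ennreal (exp (- (s powr b))) \<le> 1"
        by simp
      moreover have "1 \<le> s \<Longrightarrow> ennreal (exp (- (s powr b))) \<le> ennreal (real k ^ k * s powr (-2))"
        using bnd by (intro ennreal_leI)
      ultimately show "ennreal (exp (- (s powr b))) * indicator {0<..} s
        \<le> indicator {0..1} s + ennreal (real k ^ k * s powr (-2)) * indicator {1..} s"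
        by (auto simp: indicator_def intro: add_increasing2)
    qed
    also have "\<dots> = emeasure lborel {0..1::real} + (\<integral>\<^sup>+s. ennreal (real k ^ k * s powr (-2)) * indicator {1..} s \<partial>lborel)"
      by (subst nn_integral_add) auto
    also have "(\<integral>\<^sup>+s. ennreal (real k ^ k * s powr (-2)) * indicator {1..} s \<partial>lborel)
        = ennreal (0 - (- (real k ^ k * 1 powr (-1))))"
    proof (rule nn_integral_FTC_atLeast[where F="\<lambda>s. - (real k ^ k * s powr (-1))"])
      have "((\<lambda>s. - (real k ^ k * s powr (-1))) \<longlongrightarrow> - (real k ^ k * 0)) (at_top :: real filter)"
        by (intro tendsto_intros tendsto_neg_powr filterlim_ident) auto
      then show "((\<lambda>s. - (real k ^ k * s powr (-1))) \<longlongrightarrow> 0) (at_top :: real filter)" by simp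
          fix s :: real assume s: "1 \<le> s"
      then have "((\<lambda>s. s powr (-1)) has_real_derivative (-1) * s powr (-1 - 1)) (at s)"
        by (intro has_real_derivative_powr) simp
      then show "((\<lambda>s. - (real k ^ k * s powr (-1))) has_real_derivative real k ^ k * s powr (-2)) (at s)"
        by (rule DERIV_cong[OF DERIV_minus[OF DERIV_cmult]]) simp
    qed auto
    finally show ?thesis by (auto simp: less_top[symmetric] top_unique)
  qed
  finally show ?thesis .
qed

section \<open>The stable density as a Gaussian scale mixture\<close>

definition mixture :: "real \<Rightarrow> ennreal" where
  "mixture x = (\<integral>\<^sup>+t. ennreal (gauss_kernel t x) \<partial>S)"

lemma mixture_measurable [measurable]: "mixture \<in> borel_measurable borel"
  unfolding mixture_def[abs_def] by measurable

lemma mixture_pos: "0 < mixture x"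
proof -
  have "\<not> (AE t in S. ennreal (gauss_kernel t x) = 0)"
  proof
    assume "AE t in S. ennreal (gauss_kernel t x) = 0"
    with pos have "AE t in S. False"
      by eventually_elim (metis gauss_kernel_pos ennreal_eq_0_iff not_le)
    then show False by simp
  qed
  then show ?thesis
    unfolding mixture_def zero_less_iff_neq_zero by (subst nn_integral_0_iff_AE) auto
qed

text \<open>Given \<open>t\<close>, the product \<open>sqrt (2 * t) * z\<close> has characteristic
  function \<open>exp (- s\<^sup>2 * t)\<close>; averaging over \<open>t\<close> evaluates the
  Laplace transform of \<open>S\<close> at \<open>s\<^sup>2\<close>.\<close>

lemma char_product_normal:
  "char (distr (S \<Otimes>\<^sub>M std_normal_distribution) borel (\<lambda>(t, z). sqrt (2 * t) * z)) s
    = complex_of_real (exp (- (\<bar>s\<bar> powr (2 * b))))"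
proof -
  interpret N: real_distribution std_normal_distribution by (rule real_dist_normal_dist)
  interpret P: pair_prob_space S std_normal_distribution ..
  have "char (distr (S \<Otimes>\<^sub>M std_normal_distribution) borel (\<lambda>(t, z). sqrt (2 * t) * z)) s
    = (CLINT x|S \<Otimes>\<^sub>M std_normal_distribution. iexp (s * (case x of (t, z) \<Rightarrow> sqrt (2 * t) * z)))"
    unfolding char_def by (subst integral_distr) auto
  also have "\<dots> = (CLINT t|S. CLINT z|std_normal_distribution. iexp (s * (sqrt (2 * t) * z)))"
    by (subst P.integral_fst'[symmetric]) (auto intro!: P.integrable_const_bound[where B=1])
  also have "\<dots> = (CLINT t|S. char std_normal_distribution (s * sqrt (2 * t)))"
    by (simp add: char_def mult.assoc)
  also have "\<dots> = (CLINT t|S. complex_of_real (exp (- s\<^sup>2 * t)))"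
    by (intro integral_cong_AE, measurable, use pos in eventually_elim)
      (simp add: char_std_normal_distribution power_mult_distrib)
  also have "\<dots> = complex_of_real (\<integral>t. exp (- s\<^sup>2 * t) \<partial>S)"
    by (rule integral_complex_of_real)
  also have "(\<integral>t. exp (- s\<^sup>2 * t) \<partial>S) = exp (- (\<bar>s\<bar> powr (2 * b)))"
  proof (cases "s = 0")
    case True
    then show ?thesis using prob_space by simp
  next
    case False
    then have "(\<integral>t. exp (- s\<^sup>2 * t) \<partial>S) = exp (- (s\<^sup>2 powr b))"
      using laplace[of "s\<^sup>2"] by (subst integral_eq_nn_integral) auto
    also have "s\<^sup>2 powr b = \<bar>s\<bar> powr (2 * b)"
      using False by (simp add: powr_powr[symmetric])
    finally show ?thesis .
  qed
  finally show ?thesis .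
qed

text \<open>For fixed \<open>t > 0\<close> the substitution \<open>x = sqrt (2 * t) * z\<close>
  carries the standard normal density to \<open>gauss_kernel t\<close>; Tonelli then moves the
  average over \<open>t\<close> inside.\<close>

lemma distr_product_normal:
  "distr (S \<Otimes>\<^sub>M std_normal_distribution) borel (\<lambda>(t, z). sqrt (2 * t) * z) = density lborel mixture"
proof (rule measure_eqI)
  fix A :: "real set"
  assume "A \<in> sets (distr (S \<Otimes>\<^sub>M std_normal_distribution) borel (\<lambda>(t, z). sqrt (2 * t) * z))"
  then have [measurable]: "A \<in> sets borel" by simp
  interpret N: prob_space std_normal_distribution by (rule prob_space_normal_density) simp
  interpret P: pair_prob_space S std_normal_distribution ..
  interpret P2: pair_sigma_finite lborel S
    unfolding pair_sigma_finite_def using sigma_finite_measure_axioms sigma_finite_lborel by blast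
  have "emeasure (distr (S \<Otimes>\<^sub>M std_normal_distribution) borel (\<lambda>(t, z). sqrt (2 * t) * z)) A
      = (\<integral>\<^sup>+x. indicator A x \<partial>(distr (S \<Otimes>\<^sub>M std_normal_distribution) borel (\<lambda>(t, z). sqrt (2 * t) * z)))"
    by simp
  also have "\<dots> = (\<integral>\<^sup>+x. indicator A (case x of (t, z) \<Rightarrow> sqrt (2 * t) * z) \<partial>(S \<Otimes>\<^sub>M std_normal_distribution))"
    by (subst nn_integral_distr) auto
  also have "\<dots> = (\<integral>\<^sup>+t. \<integral>\<^sup>+z. indicator A (sqrt (2 * t) * z) \<partial>std_normal_distribution \<partial>S)"
    by (subst N.nn_integral_fst[symmetric]) auto
  also have "\<dots> = (\<integral>\<^sup>+t. \<integral>\<^sup>+x. ennreal (gauss_kernel t x) * indicator A x \<partial>lborel \<partial>S)"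
  proof (intro nn_integral_cong_AE, use pos in eventually_elim)
    fix t :: real assume t: "0 < t"
    have nd: "normal_density 0 1 z = sqrt (2 * t) * gauss_kernel t (sqrt (2 * t) * z)" for z
      using t by (simp add: normal_density_def gauss_kernel_def real_sqrt_mult power_mult_distrib field_simps)
    have "(\<integral>\<^sup>+z. indicator A (sqrt (2 * t) * z) \<partial>std_normal_distribution)
       = (\<integral>\<^sup>+z. ennreal (normal_density 0 1 z) * indicator A (sqrt (2 * t) * z) \<partial>lborel)"
      by (subst nn_integral_density) auto
    also have "\<dots> = (\<integral>\<^sup>+z. ennreal \<bar>sqrt (2 * t)\<bar> * (ennreal (gauss_kernel t (sqrt (2 * t) * z)) * indicator A (sqrt (2 * t) * z)) \<partial>lborel)"
      using t by (intro nn_integral_cong) (simp add: nd ennreal_mult' mult.assoc)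
    also have "\<dots> = ennreal \<bar>sqrt (2 * t)\<bar> * (\<integral>\<^sup>+z. ennreal (gauss_kernel t (sqrt (2 * t) * z)) * indicator A (sqrt (2 * t) * z) \<partial>lborel)"
      by (rule nn_integral_cmult) measurable
    also have "\<dots> = (\<integral>\<^sup>+x. ennreal (gauss_kernel t x) * indicator A x \<partial>lborel)"
      using t by (subst nn_integral_real_affine[where t=0 and c="sqrt (2 * t)"]) auto
    finally show "(\<integral>\<^sup>+z. indicator A (sqrt (2 * t) * z) \<partial>std_normal_distribution)
      = (\<integral>\<^sup>+x. ennreal (gauss_kernel t x) * indicator A x \<partial>lborel)" .
  qed
  also have "\<dots> = (\<integral>\<^sup>+x. \<integral>\<^sup>+t. ennreal (gauss_kernel t x) * indicator A x \<partial>S \<partial>lborel)"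
    by (rule P2.Fubini') measurable
  also have "\<dots> = (\<integral>\<^sup>+x. mixture x * indicator A x \<partial>lborel)"
    unfolding mixture_def by (intro nn_integral_cong nn_integral_multc) measurable
  also have "\<dots> = emeasure (density lborel mixture) A"
    by (simp add: emeasure_density)
  finally show "emeasure (distr (S \<Otimes>\<^sub>M std_normal_distribution) borel (\<lambda>(t, z). sqrt (2 * t) * z)) A = \<dots>" .
qed simp

lemma nn_integral_mixture: "(\<integral>\<^sup>+x. mixture x \<partial>lborel) = 1"
proof -
  interpret P2: pair_sigma_finite lborel S
    unfolding pair_sigma_finite_def using sigma_finite_measure_axioms sigma_finite_lborel by blast
  have "(\<integral>\<^sup>+x. mixture x \<partial>lborel) = (\<integral>\<^sup>+t. \<integral>\<^sup>+x. ennreal (gauss_kernel t x) \<partial>lborel \<partial>S)"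
    unfolding mixture_def by (rule P2.Fubini'[symmetric]) measurable
  also have "\<dots> = (\<integral>\<^sup>+t. 1 \<partial>S)"
    using nn_integral_gauss_kernel[of _ 0] by (intro nn_integral_cong_AE, use pos in eventually_elim) simp
  finally show ?thesis using emeasure_space_1 by simp
qed

text \<open>Cauchy--Schwarz over the mixing measure: the Hellinger affinity is jointly concave.\<close>

lemma mixture_geometric_mean:
  "(\<integral>\<^sup>+t. ennreal (sqrt (gauss_kernel t x * gauss_kernel t y)) \<partial>S)\<^sup>2 \<le> mixture x * mixture y"
proof -
  have "(\<integral>\<^sup>+t. ennreal (sqrt (gauss_kernel t x * gauss_kernel t y)) \<partial>S)
    = (\<integral>\<^sup>+t. ennreal (sqrt (gauss_kernel t x)) * ennreal (sqrt (gauss_kernel t y)) \<partial>S)"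
    by (intro nn_integral_cong_AE, use pos in eventually_elim)
      (simp add: real_sqrt_mult ennreal_mult gauss_kernel_pos less_imp_le)
  also have "\<dots>\<^sup>2 \<le> (\<integral>\<^sup>+t. ennreal (sqrt (gauss_kernel t x)) ^ 2 \<partial>S) * (\<integral>\<^sup>+t. ennreal (sqrt (gauss_kernel t y)) ^ 2 \<partial>S)"
    by (rule Cauchy_Schwarz_nn_integral) measurable
  finally have le: "(\<integral>\<^sup>+t. ennreal (sqrt (gauss_kernel t x * gauss_kernel t y)) \<partial>S)\<^sup>2
    \<le> (\<integral>\<^sup>+t. ennreal (sqrt (gauss_kernel t x)) ^ 2 \<partial>S) * (\<integral>\<^sup>+t. ennreal (sqrt (gauss_kernel t y)) ^ 2 \<partial>S)" .
  have "(\<integral>\<^sup>+t. ennreal (sqrt (gauss_kernel t w)) ^ 2 \<partial>S) = mixture w" for w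
    unfolding mixture_def by (intro nn_integral_cong_AE, use pos in eventually_elim)
      (simp add: ennreal_power gauss_kernel_pos less_imp_le)
  with le show ?thesis by simp
qed

text \<open>Concavity bounds the affinity of \<open>p\<close> from below by the average of the
  Gaussian affinities \<open>exp (- (a\<^sup>2 / (16 * t)))\<close>, and
  \<open>exp (- x) \<ge> 1 - x\<close> brings in the mean of \<open>1 / t\<close>. The additive form
  avoids subtraction in \<open>ennreal\<close>.\<close>

lemma affinity_lower_bound:
  fixes p :: "real \<Rightarrow> real"
  assumes [measurable]: "p \<in> borel_measurable borel" and nn: "\<And>x. 0 \<le> p x"
    and ae: "AE x in lborel. ennreal (p x) = mixture x"
  shows "1 \<le> (\<integral>\<^sup>+x. ennreal (sqrt (p (x - a) * p x)) \<partial>lborel) + ennreal (a\<^sup>2 / 16) * (\<integral>\<^sup>+t. ennreal (1 / t) \<partial>S)"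
proof -
  interpret P2: pair_sigma_finite lborel S
    unfolding pair_sigma_finite_def using sigma_finite_measure_axioms sigma_finite_lborel by blast
  have ae': "AE x in lborel. ennreal (p (x - a)) = mixture (x - a)"
    using AE_borel_affine[of 1 "\<lambda>x. ennreal (p x) = mixture x" "- a"] ae by simp
  have "(\<integral>\<^sup>+t. ennreal (exp (- (a\<^sup>2 / (16 * t)))) \<partial>S)
     = (\<integral>\<^sup>+t. \<integral>\<^sup>+x. ennreal (sqrt (gauss_kernel t (x - a) * gauss_kernel t x)) \<partial>lborel \<partial>S)"
  proof (intro nn_integral_cong_AE, use pos in eventually_elim)
    fix t :: real assume t: "0 < t"
    show "ennreal (exp (- (a\<^sup>2 / (16 * t)))) = (\<integral>\<^sup>+x. ennreal (sqrt (gauss_kernel t (x - a) * gauss_kernel t x)) \<partial>lborel)"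
      using nn_integral_gauss_kernel[OF t, of "- (a / 2)"]
      by (simp add: gauss_kernel_geometric_mean[OF t] ennreal_mult' nn_integral_cmult)
  qed
  also have "\<dots> = (\<integral>\<^sup>+x. \<integral>\<^sup>+t. ennreal (sqrt (gauss_kernel t (x - a) * gauss_kernel t x)) \<partial>S \<partial>lborel)"
    by (rule P2.Fubini') measurable
  also have "\<dots> \<le> (\<integral>\<^sup>+x. ennreal (sqrt (p (x - a) * p x)) \<partial>lborel)"
  proof (intro nn_integral_mono_AE, use ae ae' in eventually_elim)
    fix x assume *: "ennreal (p x) = mixture x" "ennreal (p (x - a)) = mixture (x - a)"
    define I where "I = (\<integral>\<^sup>+t. ennreal (sqrt (gauss_kernel t (x - a) * gauss_kernel t x)) \<partial>S)"
    have "I\<^sup>2 \<le> ennreal (p (x - a)) * ennreal (p x)"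
      using mixture_geometric_mean[of "x - a" x] * by (simp add: I_def)
    also have "\<dots> = (ennreal (sqrt (p (x - a) * p x)))\<^sup>2"
      using nn by (simp add: ennreal_power ennreal_mult)
    finally have "I\<^sup>2 \<le> (ennreal (sqrt (p (x - a) * p x)))\<^sup>2" .
    then show "I \<le> ennreal (sqrt (p (x - a) * p x))"
      using nn by (cases I) (auto simp: ennreal_power top_unique ennreal_top_eq_mult_iff power2_eq_square
          ennreal_mult[symmetric] ennreal_leI real_le_rsqrt)
  qed
  finally have le: "(\<integral>\<^sup>+t. ennreal (exp (- (a\<^sup>2 / (16 * t)))) \<partial>S) \<le> (\<integral>\<^sup>+x. ennreal (sqrt (p (x - a) * p x)) \<partial>lborel)" .
  have "1 = (\<integral>\<^sup>+t. 1 \<partial>S)" using emeasure_space_1 by simp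
  also have "\<dots> \<le> (\<integral>\<^sup>+t. ennreal (exp (- (a\<^sup>2 / (16 * t)))) + ennreal (a\<^sup>2 / 16) * ennreal (1 / t) \<partial>S)"
  proof (intro nn_integral_mono_AE, use pos in eventually_elim)
    fix t :: real assume t: "0 < t"
    have "1 \<le> exp (- (a\<^sup>2 / (16 * t))) + a\<^sup>2 / 16 * (1 / t)"
      using exp_ge_add_one_self[of "- (a\<^sup>2 / (16 * t))"] by simp
    then have "ennreal 1 \<le> ennreal (exp (- (a\<^sup>2 / (16 * t))) + a\<^sup>2 / 16 * (1 / t))"
      by (rule ennreal_leI)
    then show "1 \<le> ennreal (exp (- (a\<^sup>2 / (16 * t)))) + ennreal (a\<^sup>2 / 16) * ennreal (1 / t)"
      using t by (simp add: ennreal_mult'[symmetric])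
  qed
  also have "\<dots> = (\<integral>\<^sup>+t. ennreal (exp (- (a\<^sup>2 / (16 * t)))) \<partial>S) + ennreal (a\<^sup>2 / 16) * (\<integral>\<^sup>+t. ennreal (1 / t) \<partial>S)"
    by (subst nn_integral_add) (auto simp: nn_integral_cmult)
  also have "\<dots> \<le> (\<integral>\<^sup>+x. ennreal (sqrt (p (x - a) * p x)) \<partial>lborel) + ennreal (a\<^sup>2 / 16) * (\<integral>\<^sup>+t. ennreal (1 / t) \<partial>S)"
    by (intro add_mono le order_refl)
  finally show ?thesis .
qed

end

text \<open>Levy's uniqueness theorem identifies \<open>m\<close> with the mixture for
  \<open>b = \<alpha> / 2\<close>, so \<open>p\<close> agrees almost everywhere with the strictly
  positive \<open>mixture\<close>. The constant is one sixteenth of the mean of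
  \<open>1 / t\<close>.\<close>

lemma stable_density_properties:
  assumes \<alpha>: "0 < \<alpha>" "\<alpha> \<le> 2"
    and stab: "symmetric_stable_law \<alpha> m" and dens: "lborel_density_of m p"
  shows "(AE x in lborel. 0 < p x) \<and>
    (\<exists>C\<ge>0. \<forall>a. 1 - C * a\<^sup>2 \<le> enn2real (\<integral>\<^sup>+x. ennreal (sqrt (p (x - a) * p x)) \<partial>lborel))"
proof -
  have p [measurable]: "p \<in> borel_measurable borel" and nn: "\<And>x. 0 \<le> p x"
    and m: "m = density lborel (\<lambda>x. ennreal (p x))"
    using dens by (auto simp: lborel_density_of_def)
  have rm: "real_distribution m" and cm: "\<And>s. char m s = complex_of_real (exp (- (\<bar>s\<bar> powr \<alpha>)))"
    using stab by (auto simp: symmetric_stable_law_def)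
  obtain S where S: "real_distribution S" "AE t in S. 0 < t"
    "\<And>s. 0 < s \<Longrightarrow> (\<integral>\<^sup>+t. ennreal (exp (- s * t)) \<partial>S) = ennreal (exp (- (s powr (\<alpha> / 2))))"
    using positive_stable_exists[of "\<alpha> / 2"] \<alpha> by auto
  interpret positive_stable S "\<alpha> / 2"
    using S \<alpha> by (intro positive_stable.intro positive_stable_axioms.intro) auto
  interpret N: prob_space std_normal_distribution by (rule prob_space_normal_density) simp
  interpret P: pair_prob_space S std_normal_distribution ..
  have "m = distr (S \<Otimes>\<^sub>M std_normal_distribution) borel (\<lambda>(t, z). sqrt (2 * t) * z)"
    by (rule Levy_uniqueness[OF rm]) (auto simp: fun_eq_iff cm char_product_normal)
  then have eq: "density lborel (\<lambda>x. ennreal (p x)) = density lborel mixture"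
    by (simp add: m distr_product_normal)
  then have ae: "AE x in lborel. ennreal (p x) = mixture x"
    by (intro sigma_finite_measure.density_unique[OF sigma_finite_lborel]) auto
  obtain C where C: "(\<integral>\<^sup>+t. ennreal (1 / t) \<partial>S) = ennreal C" "0 \<le> C"
    using nn_integral_inverse_finite by (cases "\<integral>\<^sup>+t. ennreal (1 / t) \<partial>S") auto
  show ?thesis
  proof (intro conjI exI[of _ "C / 16"] allI)
    show "AE x in lborel. 0 < p x"
      using ae by eventually_elim (metis mixture_pos ennreal_less_zero_iff)
    show "0 \<le> C / 16" using C by simp
    \<comment> \<open>Finiteness of the affinity comes first, because \<open>enn2real\<close> sends
      infinity to 0.\<close>
    fix a
    have "(\<integral>\<^sup>+x. ennreal (sqrt (p (x - a) * p x)) \<partial>lborel) < \<infinity>"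
    proof -
      have "(\<integral>\<^sup>+x. ennreal (sqrt (p (x - a) * p x)) \<partial>lborel) \<le> (\<integral>\<^sup>+x. ennreal (p (x - a)) + ennreal (p x) \<partial>lborel)"
      proof (intro nn_integral_mono)
        fix x
        have "sqrt (p (x - a) * p x) \<le> p (x - a) + p x"
          using arith_geo_mean_sqrt[of "p (x - a)" "p x"] nn[of x] nn[of "x - a"] by simp
        then show "ennreal (sqrt (p (x - a) * p x)) \<le> ennreal (p (x - a)) + ennreal (p x)"
          using nn by (simp add: ennreal_plus[symmetric] ennreal_leI del: ennreal_plus)
      qed
      also have "\<dots> = (\<integral>\<^sup>+x. ennreal (p (x - a)) \<partial>lborel) + (\<integral>\<^sup>+x. ennreal (p x) \<partial>lborel)"
        by (rule nn_integral_add) auto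
      also have "(\<integral>\<^sup>+x. ennreal (p x) \<partial>lborel) = 1"
        using ae nn_integral_mixture by (simp cong: nn_integral_cong_AE)
      also have "(\<integral>\<^sup>+x. ennreal (p (x - a)) \<partial>lborel) = (\<integral>\<^sup>+x. ennreal (p x) \<partial>lborel)"
        by (subst (2) nn_integral_real_affine[where t="-a" and c=1]) auto
      also have "(\<integral>\<^sup>+x. ennreal (p x) \<partial>lborel) = 1"
        using ae nn_integral_mixture by (simp cong: nn_integral_cong_AE)
      finally show ?thesis by (rule le_less_trans) simp
    qed
    then obtain J where J: "(\<integral>\<^sup>+x. ennreal (sqrt (p (x - a) * p x)) \<partial>lborel) = ennreal J" "0 \<le> J"
      by (cases "\<integral>\<^sup>+x. ennreal (sqrt (p (x - a) * p x)) \<partial>lborel") auto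
    have "ennreal 1 \<le> ennreal (J + a\<^sup>2 / 16 * C)"
      using affinity_lower_bound[OF p nn ae, of a] J C
      by (simp add: ennreal_mult'[symmetric] ennreal_plus[symmetric] del: ennreal_plus)
    then have "1 \<le> J + a\<^sup>2 / 16 * C"
      using J C by (subst (asm) ennreal_le_iff) auto
    then show "1 - C / 16 * a\<^sup>2 \<le> enn2real (\<integral>\<^sup>+x. ennreal (sqrt (p (x - a) * p x)) \<partial>lborel)"
      using J by (simp add: field_simps)
  qed
qed

section \<open>Square-summability of the scaled stable sequence\<close>

text \<open>Parseval: integrating \<open>iexp (q * x * y)\<close> first over a standard normal \<open>y\<close>, then over \<open>x\<close>, or in the
  opposite order.\<close>

lemma integral_gaussian_eq_integral_char:
  assumes "real_distribution m"
  shows "complex_of_real (\<integral>x. exp (- (q * x)\<^sup>2 / 2) \<partial>m) = (CLINT y|std_normal_distribution. char m (q * y))"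
proof -
  interpret m: real_distribution m by fact
  interpret N: real_distribution std_normal_distribution by (rule real_dist_normal_dist)
  interpret P: pair_prob_space m std_normal_distribution ..
  have "complex_of_real (\<integral>x. exp (- (q * x)\<^sup>2 / 2) \<partial>m) = (CLINT x|m. char std_normal_distribution (q * x))"
    by (simp add: char_std_normal_distribution)
  also have "\<dots> = (CLINT x|m. CLINT y|std_normal_distribution. iexp (q * x * y))"
    by (simp add: char_def)
  also have "\<dots> = (CLINT y|std_normal_distribution. CLINT x|m. iexp (q * x * y))"
    by (rule P.Fubini_integral[symmetric]) (auto intro!: P.integrable_const_bound[where B=1])
  also have "\<dots> = (CLINT y|std_normal_distribution. char m (q * y))"
    by (simp add: char_def mult_ac)
  finally show ?thesis .
qed

text \<open>Parseval turns the left side into the mean of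
  \<open>1 - exp (- (\<bar>q * y\<bar> powr \<alpha>))\<close> over a standard normal
  \<open>y\<close>, which is at most \<open>q powr \<alpha>\<close> times the mean of
  \<open>1 + y\<^sup>2\<close>, that is 2. The bounded integrand stands in for the square, whose
  mean is infinite for \<alpha> < 2.\<close>

lemma stable_truncated_second_moment:
  assumes \<alpha>: "0 < \<alpha>" "\<alpha> \<le> 2" and stab: "symmetric_stable_law \<alpha> m" and q: "0 < q"
  shows "(\<integral>\<^sup>+x. ennreal (1 - exp (- (q * x)\<^sup>2 / 2)) \<partial>m) \<le> ennreal (2 * q powr \<alpha>)"
proof -
  have rd: "real_distribution m" and ch: "\<And>s. char m s = complex_of_real (exp (- (\<bar>s\<bar> powr \<alpha>)))"
    using stab by (auto simp: symmetric_stable_law_def)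
  interpret m: real_distribution m by fact
  interpret N: real_distribution std_normal_distribution by (rule real_dist_normal_dist)
  have im: "integrable m (\<lambda>x. exp (- (q * x)\<^sup>2 / 2))"
    by (rule m.integrable_const_bound[where B=1]) auto
  have iN: "integrable std_normal_distribution (\<lambda>y. exp (- (\<bar>q * y\<bar> powr \<alpha>)))"
    by (rule N.integrable_const_bound[where B=1]) auto
  have i2: "integrable std_normal_distribution (\<lambda>y. y\<^sup>2)" "(\<integral>y. y\<^sup>2 \<partial>std_normal_distribution) = 1"
    using integrable_std_normal_moment[of 2] integral_std_normal_moment_even[of 1]
    by (simp_all add: integrable_density integral_density)
  have "complex_of_real (\<integral>x. exp (- (q * x)\<^sup>2 / 2) \<partial>m)
      = complex_of_real (\<integral>y. exp (- (\<bar>q * y\<bar> powr \<alpha>)) \<partial>std_normal_distribution)"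
    by (subst integral_gaussian_eq_integral_char[OF rd]) (simp add: ch)
  then have eq: "(\<integral>x. exp (- (q * x)\<^sup>2 / 2) \<partial>m) = (\<integral>y. exp (- (\<bar>q * y\<bar> powr \<alpha>)) \<partial>std_normal_distribution)"
    by (simp only: of_real_eq_iff)
  have "(\<integral>x. 1 - exp (- (q * x)\<^sup>2 / 2) \<partial>m) = (\<integral>y. 1 - exp (- (\<bar>q * y\<bar> powr \<alpha>)) \<partial>std_normal_distribution)"
    using im iN eq m.prob_space N.prob_space by simp
  also have "\<dots> \<le> (\<integral>y. q powr \<alpha> * (1 + y\<^sup>2) \<partial>std_normal_distribution)"
  proof (rule integral_mono)
    fix y :: real
    have "\<bar>y\<bar> powr \<alpha> \<le> 1 + y\<^sup>2"
    proof (cases "\<bar>y\<bar> \<le> 1")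
      case True
      then have "\<bar>y\<bar> powr \<alpha> \<le> 1" using \<alpha> by (intro powr_le1) auto
      then show ?thesis by (smt (verit) zero_le_power2)
    next
      case False
      then have "\<bar>y\<bar> powr \<alpha> \<le> \<bar>y\<bar> powr 2" using \<alpha> by (intro powr_mono) auto
      also have "\<bar>y\<bar> powr 2 = y\<^sup>2" using False by (simp add: powr_numeral)
      finally show ?thesis by simp
    qed
    then have "\<bar>q * y\<bar> powr \<alpha> \<le> q powr \<alpha> * (1 + y\<^sup>2)"
      using q by (simp add: abs_mult powr_mult)
    moreover have "1 - exp (- (\<bar>q * y\<bar> powr \<alpha>)) \<le> \<bar>q * y\<bar> powr \<alpha>"
      using exp_ge_add_one_self[of "- (\<bar>q * y\<bar> powr \<alpha>)"] by linarith
    ultimately show "1 - exp (- (\<bar>q * y\<bar> powr \<alpha>)) \<le> q powr \<alpha> * (1 + y\<^sup>2)" by linarith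
  qed (use iN i2 in auto)
  also have "\<dots> = 2 * q powr \<alpha>"
    using i2 N.prob_space by simp
  finally have le: "(\<integral>x. 1 - exp (- (q * x)\<^sup>2 / 2) \<partial>m) \<le> 2 * q powr \<alpha>" .
  have "(\<integral>\<^sup>+x. ennreal (1 - exp (- (q * x)\<^sup>2 / 2)) \<partial>m) = ennreal (\<integral>x. 1 - exp (- (q * x)\<^sup>2 / 2) \<partial>m)"
    using im by (intro nn_integral_eq_integral) auto
  then show ?thesis using le by (simp add: ennreal_leI)
qed

text \<open>The terms tend to 0, so eventually \<open>w k \<le> 1\<close>, and there
  \<open>1 - exp (- w k) \<ge> w k / 2\<close>.\<close>

lemma summable_of_summable_one_minus_exp:
  fixes w :: "nat \<Rightarrow> real"
  assumes w: "\<And>k. 0 \<le> w k" and s: "summable (\<lambda>k. 1 - exp (- w k))"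
  shows "summable w"
proof -
  have "\<forall>\<^sub>F k in sequentially. 1 - exp (- w k) < 1 / 2"
    using summable_LIMSEQ_zero[OF s] by (rule order_tendstoD) simp
  then have "\<forall>\<^sub>F k in sequentially. norm (w k) \<le> 2 * (1 - exp (- w k))"
  proof eventually_elim
    case (elim k)
    have e: "1 + w k \<le> exp (w k)" by (rule exp_ge_add_one_self)
    have "exp (w k) < 2"
      using elim by (simp add: exp_minus field_simps)
    then have w1: "w k \<le> 1" using e by linarith
    have "exp (- w k) \<le> 1 / (1 + w k)"
      using e w[of k] by (simp add: exp_minus field_simps)
    also have "\<dots> \<le> 1 - w k / 2"
    proof -
      have "0 \<le> w k * (1 - w k)" using w[of k] w1 by simp
      then show ?thesis using w[of k] by (simp add: field_simps)
    qed
    finally show ?case using w[of k] by simp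
  qed
  then show ?thesis
    by (rule summable_comparison_test_ev) (intro summable_mult s)
qed

text \<open>By Tonelli and \<open>stable_truncated_second_moment\<close> the series of
  \<open>1 - exp (- (q k * \<xi> k \<omega>)\<^sup>2 / 2)\<close> has finite mean. It thus converges
  almost surely, and \<open>summable_of_summable_one_minus_exp\<close> recovers the squares.\<close>

lemma (in prob_space) AE_summable_stable_sq:
  fixes \<xi> :: "nat \<Rightarrow> 'a \<Rightarrow> real"
  assumes \<alpha>: "0 < \<alpha>" "\<alpha> \<le> 2" and stab: "symmetric_stable_law \<alpha> m"
    and rv [measurable]: "\<And>k. \<xi> k \<in> borel_measurable M" and law: "\<And>k. distr M borel (\<xi> k) = m"
    and q: "\<And>k. 0 < q k" and sm: "summable (\<lambda>k. q k powr \<alpha>)"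
  shows "AE \<omega> in M. summable (\<lambda>k. (q k * \<xi> k \<omega>)\<^sup>2)"
proof -
  have "(\<integral>\<^sup>+\<omega>. (\<Sum>k. ennreal (1 - exp (- (q k * \<xi> k \<omega>)\<^sup>2 / 2))) \<partial>M)
      = (\<Sum>k. \<integral>\<^sup>+\<omega>. ennreal (1 - exp (- (q k * \<xi> k \<omega>)\<^sup>2 / 2)) \<partial>M)"
    by (rule nn_integral_suminf) measurable
  also have "\<dots> = (\<Sum>k. \<integral>\<^sup>+x. ennreal (1 - exp (- (q k * x)\<^sup>2 / 2)) \<partial>m)"
    by (intro suminf_cong) (subst law[symmetric], simp add: nn_integral_distr)
  also have "\<dots> \<le> (\<Sum>k. ennreal (2 * q k powr \<alpha>))"
    by (intro suminf_le stable_truncated_second_moment[OF \<alpha> stab q]) auto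
  also have "\<dots> = ennreal (\<Sum>k. 2 * q k powr \<alpha>)"
    using sm by (intro suminf_ennreal2) (auto intro: summable_mult)
  also have "\<dots> < \<infinity>" by simp
  finally have "AE \<omega> in M. (\<Sum>k. ennreal (1 - exp (- (q k * \<xi> k \<omega>)\<^sup>2 / 2))) \<noteq> \<infinity>"
    by (intro nn_integral_PInf_AE) auto
  then show ?thesis
  proof eventually_elim
    case (elim \<omega>)
    then have "summable (\<lambda>k. 1 - exp (- (q k * \<xi> k \<omega>)\<^sup>2 / 2))"
      by (intro summable_suminf_not_top) auto
    then have "summable (\<lambda>k. (q k * \<xi> k \<omega>)\<^sup>2 / 2)"
      using summable_of_summable_one_minus_exp[of "\<lambda>k. (q k * \<xi> k \<omega>)\<^sup>2 / 2"] by simp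
    from summable_mult[OF this, of 2] show ?case by simp
  qed
qed

section \<open>Borel sets of the sequence space\<close>

lemma norm_ell2_eq: "norm x = sqrt (\<Sum>k. (coord x k)\<^sup>2)" for x :: ell2
  by (simp add: norm_ell2_def inner_ell2_def power2_eq_square)

lemma to_ell2_coord [simp]: "to_ell2 (coord x) = x"
  by (simp add: to_ell2_def summable_coord_sq coord_inverse)

lemma abs_coord_le_norm: "\<bar>coord x k\<bar> \<le> norm x"
proof -
  have "(coord x k)\<^sup>2 \<le> (\<Sum>k. (coord x k)\<^sup>2)"
    using sum_le_suminf[OF summable_coord_sq, of "{k}" x] by simp
  then show ?thesis
    by (simp add: norm_ell2_eq real_le_rsqrt)
qed

lemma continuous_coord: "continuous_on UNIV (\<lambda>x. coord x k)"
  unfolding continuous_on_iff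
proof (intro ballI allI impI)
  fix x :: ell2 and e :: real assume "0 < e"
  moreover have "dist (coord y k) (coord x k) \<le> dist y x" for y
    using abs_coord_le_norm[of "y - x" k] by (simp add: dist_norm minus_ell2.rep_eq)
  ultimately show "\<exists>d>0. \<forall>y\<in>UNIV. dist y x < d \<longrightarrow> dist (coord y k) (coord x k) < e"
    by (meson le_less_trans)
qed

lemma borel_measurable_coord [measurable]: "(\<lambda>x. coord x k) \<in> borel_measurable borel"
  by (rule borel_measurable_continuous_onI[OF continuous_coord])

text \<open>Lists form a countable type, so a union indexed by them is a countable union.\<close>

definition rational_ell2 :: "rat list \<Rightarrow> ell2" where
  "rational_ell2 rs = to_ell2 (\<lambda>k. if k < length rs then of_rat (rs ! k) else 0)"

lemma coord_rational_ell2: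
  "coord (rational_ell2 rs) k = (if k < length rs then of_rat (rs ! k) else 0)"
proof -
  have "summable (\<lambda>k. (if k < length rs then of_rat (rs ! k) else 0 :: real)\<^sup>2)"
    by (rule summable_finite[of "{..<length rs}"]) auto
  then show ?thesis by (simp add: rational_ell2_def coord_to_ell2)
qed

lemma rational_ell2_dense:
  assumes e: "0 < e"
  shows "\<exists>rs. dist (rational_ell2 rs) x < e"
proof -
  obtain n where "norm (\<Sum>k. (coord x (k + n))\<^sup>2) < e\<^sup>2 / 2"
    using suminf_exist_split[OF _ summable_coord_sq, of "e\<^sup>2 / 2" x] e by auto
  then have n: "(\<Sum>k. (coord x (k + n))\<^sup>2) < e\<^sup>2 / 2" by simp
  \<comment> \<open>The tail takes half of \<open>e\<^sup>2\<close>, and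
    \<open>n * d\<^sup>2 \<le> e\<^sup>2 / 2\<close> covers the first \<open>n\<close> coordinates;
    \<open>n + 1\<close> keeps the denominator positive when \<open>n = 0\<close>.\<close>
  define d where "d = e / sqrt (2 * (n + 1))"
  have d: "0 < d" using e by (simp add: d_def)
  have "\<exists>r::rat. \<bar>of_rat r - coord x k\<bar> < d" for k
  proof -
    obtain r where "r \<in> \<rat>" "coord x k - d < r" "r < coord x k + d"
      using Rats_dense_in_real[of "coord x k - d" "coord x k + d"] d by auto
    then have "\<bar>r - coord x k\<bar> < d" by (simp add: abs_less_iff)
    with \<open>r \<in> \<rat>\<close> show ?thesis by (auto elim!: Rats_cases)
  qed
  then obtain f :: "nat \<Rightarrow> rat" where f: "\<And>k. \<bar>of_rat (f k) - coord x k\<bar> < d" by metis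
  define y where "y = rational_ell2 (map f [0..<n])"
  have c: "coord (y - x) k = (if k < n then of_rat (f k) else 0) - coord x k" for k
    by (simp add: y_def minus_ell2.rep_eq coord_rational_ell2)
  have "(\<Sum>k. (coord (y - x) k)\<^sup>2) = (\<Sum>k. (coord (y - x) (k + n))\<^sup>2) + (\<Sum>k<n. (coord (y - x) k)\<^sup>2)"
    by (rule suminf_split_initial_segment[OF summable_coord_sq])
  also have "(\<Sum>k. (coord (y - x) (k + n))\<^sup>2) = (\<Sum>k. (coord x (k + n))\<^sup>2)"
    by (simp add: c)
  also have "(\<Sum>k<n. (coord (y - x) k)\<^sup>2) \<le> (\<Sum>k<n. d\<^sup>2)"
    using f d by (intro sum_mono) (simp add: c abs_le_square_iff[symmetric] less_imp_le)
  also have "(\<Sum>k<n. d\<^sup>2) \<le> e\<^sup>2 / 2"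
    using e by (simp add: d_def power_divide field_simps)
  finally have "(\<Sum>k. (coord (y - x) k)\<^sup>2) < e\<^sup>2" using n by simp
  then have "dist y x < e"
    using e by (simp add: dist_norm norm_ell2_eq real_less_lsqrt)
  then show ?thesis by (auto simp: y_def)
qed

text \<open>Separability of \<open>ell2\<close> lets every open set be written as a countable union of balls around
  finitely supported rational sequences.\<close>

lemma measurable_ell2I:
  assumes X: "\<And>k. (\<lambda>\<omega>. coord (X \<omega>) k) \<in> borel_measurable M"
  shows "X \<in> borel_measurable M"
proof (rule borel_measurableI)
  fix U :: "ell2 set" assume U: "open U"
  define I where "I = {p :: rat list \<times> rat. ball (rational_ell2 (fst p)) (of_rat (snd p)) \<subseteq> U}"
  have Un: "U = (\<Union>p\<in>I. ball (rational_ell2 (fst p)) (of_rat (snd p)))"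
  proof (intro equalityI subsetI)
    fix x assume "x \<in> U"
    then obtain e where e: "0 < e" "ball x e \<subseteq> U"
      using U open_contains_ball by blast
    \<comment> \<open>A radius below \<open>e / 2\<close> around a centre within \<open>q'\<close>
      of \<open>x\<close> gives a ball that contains \<open>x\<close> and stays inside
      \<open>ball x e\<close>.\<close>
    obtain q' where "q' \<in> \<rat>" and q': "0 < q'" "q' < e / 2"
      using Rats_dense_in_real[of 0 "e / 2"] e by auto
    then obtain q where q: "q' = of_rat q" by (auto elim: Rats_cases)
    obtain rs where rs: "dist (rational_ell2 rs) x < q'"
      using rational_ell2_dense[OF q'(1)] by blast
    have "ball (rational_ell2 rs) q' \<subseteq> ball x e"
    proof
      fix y assume "y \<in> ball (rational_ell2 rs) q'"
      then show "y \<in> ball x e"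
        using rs q' dist_triangle[of x y "rational_ell2 rs"] by (simp add: dist_commute)
    qed
    with e have "(rs, q) \<in> I" using q' by (auto simp: I_def q)
    then show "x \<in> (\<Union>p\<in>I. ball (rational_ell2 (fst p)) (of_rat (snd p)))"
      using rs by (auto simp: q intro!: bexI[of _ "(rs, q)"])
  qed (auto simp: I_def)
  have [measurable]: "(\<lambda>\<omega>. dist c (X \<omega>)) \<in> borel_measurable M" for c
    unfolding dist_norm norm_ell2_eq minus_ell2.rep_eq using X by measurable
  have "X -` U \<inter> space M = (\<Union>p\<in>I. {\<omega> \<in> space M. dist (rational_ell2 (fst p)) (X \<omega>) < of_rat (snd p)})"
    by (subst Un) (simp add: set_eq_iff, blast)
  also have "\<dots> \<in> sets M"
    by (intro sets.countable_UN'') auto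
  finally show "X -` U \<inter> space M \<in> sets M" .
qed

lemma measurable_to_ell2 [measurable]: "to_ell2 \<in> borel_measurable (PiM UNIV (\<lambda>_. borel))"
proof (rule measurable_ell2I)
  fix k
  have "coord (to_ell2 x) k = (if summable (\<lambda>k. (x k)\<^sup>2) then x k else 0)" for x
    by (cases "summable (\<lambda>k. (x k)\<^sup>2)") (simp_all add: coord_to_ell2, simp add: to_ell2_def zero_ell2.rep_eq)
  \<comment> \<open>Through the Cauchy criterion, summability becomes a countable combination of
    measurable conditions.\<close>
  moreover have "Measurable.pred (PiM UNIV (\<lambda>_. borel)) (\<lambda>x::nat \<Rightarrow> real. Cauchy (\<lambda>n. \<Sum>k<n. (x k)\<^sup>2))"
    unfolding pred_def by measurable
  ultimately show "(\<lambda>x. coord (to_ell2 x) k) \<in> borel_measurable (PiM UNIV (\<lambda>_. borel))"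
    by (simp add: summable_iff_convergent Cauchy_convergent_iff[symmetric])
qed

text \<open>\<open>coord\<close> transports both measures to the product space, where cylinder sets
  determine a finite measure; \<open>to_ell2\<close>, a left inverse of \<open>coord\<close>, brings
  the equality back.\<close>

lemma ell2_measure_eqI:
  fixes P Q :: "ell2 measure"
  assumes P: "sets P = sets borel" and Q: "sets Q = sets borel" and fin: "finite_measure P"
    and eq: "\<And>N A. (\<And>k. A k \<in> sets borel) \<Longrightarrow>
      emeasure P {z. \<forall>k<N. coord z k \<in> A k} = emeasure Q {z. \<forall>k<N. coord z k \<in> A k}"
  shows "P = Q"
proof -
  let ?Pi = "PiM UNIV (\<lambda>_::nat. borel :: real measure)"
  note [measurable_cong] = P Q
  have sp: "space P = UNIV" "space Q = UNIV"
    using sets_eq_imp_space_eq[OF P] sets_eq_imp_space_eq[OF Q] by auto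
  have cm [measurable]: "coord \<in> measurable borel ?Pi"
    by (rule measurable_PiM_single') (auto simp: space_PiM)
  interpret P: finite_measure P by fact
  have "distr P ?Pi coord = distr Q ?Pi coord"
  proof (rule measure_eqI_PiM_infinite)
    show "finite_measure (distr P ?Pi coord)"
      by (rule P.finite_measure_distr) measurable
    fix A :: "nat \<Rightarrow> real set" and J :: "nat set"
    assume J: "finite J" and A: "\<And>i. i \<in> J \<Longrightarrow> A i \<in> sets borel"
    obtain N where N: "J \<subseteq> {..<N}" using finite_nat_iff_bounded J by blast
    \<comment> \<open>Filling up with \<open>UNIV\<close> outside \<open>J\<close> turns a cylinder
      over \<open>J\<close> into one over the initial segment below \<open>N\<close>.\<close>
    define B where "B k = (if k \<in> J then A k else UNIV)" for k
    have B: "B k \<in> sets borel" for k using A by (simp add: B_def)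
    have vimage: "coord -` prod_emb UNIV (\<lambda>_. borel) J (Pi\<^sub>E J A) = {z. \<forall>k<N. coord z k \<in> B k}"
      using N by (auto simp: prod_emb_def B_def restrict_PiE_iff subset_eq)
    have [measurable]: "prod_emb UNIV (\<lambda>_. borel) J (Pi\<^sub>E J A) \<in> sets ?Pi"
      using J A by (intro sets_PiM_I) auto
    show "emeasure (distr P ?Pi coord) (prod_emb UNIV (\<lambda>_. borel) J (Pi\<^sub>E J A)) =
        emeasure (distr Q ?Pi coord) (prod_emb UNIV (\<lambda>_. borel) J (Pi\<^sub>E J A))"
      by (simp add: emeasure_distr vimage sp eq[OF B])
  qed simp_all
  then have "distr (distr P ?Pi coord) borel to_ell2 = distr (distr Q ?Pi coord) borel to_ell2"
    by simp
  then have "distr P borel (to_ell2 \<circ> coord) = distr Q borel (to_ell2 \<circ> coord)"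
    by (simp add: distr_distr)
  then show ?thesis
    by (simp add: comp_def distr_id2 P Q)
qed

section \<open>Likelihood ratios of shifted product laws\<close>

text \<open>Weierstrass's product inequality; the induction step is
  \<open>(1 - f i) * (1 - prod f I) \<ge> 0\<close>.\<close>

lemma one_minus_sum_le_prod:
  fixes f :: "'a \<Rightarrow> real"
  assumes "finite I" "\<And>i. i \<in> I \<Longrightarrow> 0 \<le> f i" "\<And>i. i \<in> I \<Longrightarrow> f i \<le> 1"
  shows "1 - (\<Sum>i\<in>I. 1 - f i) \<le> prod f I"
  using assms
proof (induction I rule: finite_induct)
  case (insert i I)
  have "0 \<le> (1 - f i) * (1 - prod f I)"
    using insert by (intro mult_nonneg_nonneg) (auto intro!: prod_le_1)
  moreover have "1 - (\<Sum>i\<in>I. 1 - f i) \<le> prod f I"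
    using insert by auto
  ultimately show ?case
    using insert by (simp add: algebra_simps)
qed simp

text \<open>A subsequence converges almost everywhere, and Fatou's lemma along it carries the Cauchy
  bound over to the distance from its pointwise limit.\<close>

lemma L1_Cauchy_imp_convergent:
  fixes s :: "nat \<Rightarrow> 'a \<Rightarrow> real"
  assumes s [measurable]: "\<And>n. integrable M (s n)"
    and C: "\<And>e. e > 0 \<Longrightarrow> \<exists>N. \<forall>i\<ge>N. \<forall>j\<ge>N. (\<integral>x. \<bar>s i x - s j x\<bar> \<partial>M) < e"
  shows "\<exists>f. integrable M f \<and> (\<lambda>n. \<integral>x. \<bar>s n x - f x\<bar> \<partial>M) \<longlonglongrightarrow> 0"
proof -
  obtain r where r: "strict_mono r" and ae: "AE x in M. Cauchy (\<lambda>i. s (r i) x)"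
    using cauchy_L1_AE_cauchy_subseq[of M s] s C by auto
  define f where "f x = (if Cauchy (\<lambda>i. s (r i) x) then lim (\<lambda>i. s (r i) x) else 0)" for x
  have [measurable]: "s n \<in> borel_measurable M" for n using s by simp
  have f [measurable]: "f \<in> borel_measurable M"
    unfolding f_def by measurable
  have lim: "AE x in M. (\<lambda>i. s (r i) x) \<longlonglongrightarrow> f x"
    using ae by eventually_elim (simp add: f_def Cauchy_convergent_iff convergent_LIMSEQ_iff)
  have bd: "\<exists>N. \<forall>n\<ge>N. (\<integral>\<^sup>+x. ennreal \<bar>s n x - f x\<bar> \<partial>M) \<le> ennreal e" if e: "e > 0" for e
  proof -
    obtain N where N: "\<And>i j. N \<le> i \<Longrightarrow> N \<le> j \<Longrightarrow> (\<integral>x. \<bar>s i x - s j x\<bar> \<partial>M) < e"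
      using C[OF e] by blast
    show ?thesis
    proof (intro exI[of _ N] allI impI)
      fix n assume n: "N \<le> n"
      have "(\<integral>\<^sup>+x. ennreal \<bar>s n x - f x\<bar> \<partial>M) = (\<integral>\<^sup>+x. liminf (\<lambda>i. ennreal \<bar>s n x - s (r i) x\<bar>) \<partial>M)"
      proof (intro nn_integral_cong_AE, use lim in eventually_elim)
        fix x assume "(\<lambda>i. s (r i) x) \<longlonglongrightarrow> f x"
        then have "(\<lambda>i. ennreal \<bar>s n x - s (r i) x\<bar>) \<longlonglongrightarrow> ennreal \<bar>s n x - f x\<bar>"
          by (intro tendsto_intros)
        then show "ennreal \<bar>s n x - f x\<bar> = liminf (\<lambda>i. ennreal \<bar>s n x - s (r i) x\<bar>)"
          by (rule lim_imp_Liminf[OF trivial_limit_sequentially, symmetric])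
      qed
      also have "\<dots> \<le> liminf (\<lambda>i. \<integral>\<^sup>+x. ennreal \<bar>s n x - s (r i) x\<bar> \<partial>M)"
        by (rule nn_integral_liminf) measurable
      also have "\<dots> \<le> ennreal e"
      proof (rule Liminf_le)
        show "\<forall>\<^sub>F i in sequentially. (\<integral>\<^sup>+x. ennreal \<bar>s n x - s (r i) x\<bar> \<partial>M) \<le> ennreal e"
          using eventually_ge_at_top[of N]
        proof eventually_elim
          case (elim i)
          then have "N \<le> r i" using seq_suble[OF r, of i] by linarith
          from N[OF n this] show ?case
            using s by (subst nn_integral_eq_integral) (auto intro!: ennreal_leI)
        qed
      qed simp
      finally show "(\<integral>\<^sup>+x. ennreal \<bar>s n x - f x\<bar> \<partial>M) \<le> ennreal e" .
    qed
  qed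
  have int: "integrable M f"
  proof -
    obtain N where "(\<integral>\<^sup>+x. ennreal \<bar>s N x - f x\<bar> \<partial>M) \<le> ennreal 1"
      using bd[of 1] by auto
    then have "integrable M (\<lambda>x. s N x - f x)"
      by (intro integrableI_bounded) (auto intro: le_less_trans)
    from Bochner_Integration.integrable_diff[OF s[of N] this] show ?thesis by simp
  qed
  have "(\<lambda>n. \<integral>x. \<bar>s n x - f x\<bar> \<partial>M) \<longlonglongrightarrow> 0"
  proof (rule LIMSEQ_I)
    fix e :: real assume e: "0 < e"
    then obtain N where N: "\<And>n. N \<le> n \<Longrightarrow> (\<integral>\<^sup>+x. ennreal \<bar>s n x - f x\<bar> \<partial>M) \<le> ennreal (e / 2)"
      using bd[of "e / 2"] by auto
    have "(\<integral>x. \<bar>s n x - f x\<bar> \<partial>M) \<le> e / 2" if "N \<le> n" for n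
      using N[OF that] s int e by (subst (asm) nn_integral_eq_integral) (auto simp: ennreal_le_iff)
    then show "\<exists>N. \<forall>n\<ge>N. norm ((\<integral>x. \<bar>s n x - f x\<bar> \<partial>M) - 0) < e"
      using e by (intro exI[of _ N]) (auto intro: le_less_trans[of _ "e / 2"])
  qed
  with int show ?thesis by blast
qed

text \<open>The likelihood argument sees the stable law only through a density that is positive
  almost everywhere, the quadratic bound on its affinity with translates, and almost sure
  square-summability.\<close>

locale scaled_iid_sequence = prob_space M for M :: "'a measure" +
  fixes \<xi> :: "nat \<Rightarrow> 'a \<Rightarrow> real" and p :: "real \<Rightarrow> real" and q :: "nat \<Rightarrow> real" and C :: real
  assumes indep: "indep_vars (\<lambda>_. borel) \<xi> UNIV"
    and law: "distr M borel (\<xi> k) = density lborel (\<lambda>x. ennreal (p x))"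
    and p_measurable [measurable]: "p \<in> borel_measurable borel"
    and p_nonneg: "0 \<le> p x"
    and p_pos: "AE x in lborel. 0 < p x"
    and C_nonneg: "0 \<le> C"
    and affinity: "1 - C * a\<^sup>2 \<le> enn2real (\<integral>\<^sup>+x. ennreal (sqrt (p (x - a) * p x)) \<partial>lborel)"
    and q_pos: "0 < q k"
    and sq_summable: "AE \<omega> in M. summable (\<lambda>k. (q k * \<xi> k \<omega>)\<^sup>2)"
begin

section \<open>Laws of the shifted sequence\<close>

lemma xi_measurable [measurable]: "\<xi> k \<in> borel_measurable M"
  using indep by (simp add: indep_vars_def)

definition X :: "'a \<Rightarrow> ell2" where
  "X \<omega> = to_ell2 (\<lambda>k. q k * \<xi> k \<omega>)"

lemma X_measurable [measurable]: "X \<in> borel_measurable M"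
proof -
  have "(\<lambda>\<omega> k. q k * \<xi> k \<omega>) \<in> measurable M (PiM UNIV (\<lambda>_. borel))"
    by (rule measurable_PiM_single') (auto simp: space_PiM)
  then show ?thesis
    unfolding X_def by (rule measurable_compose[OF _ measurable_to_ell2])
qed

lemma X_add_measurable [measurable]: "(\<lambda>\<omega>. X \<omega> + u) \<in> borel_measurable M"
proof -
  have "(\<lambda>x::ell2. x + u) \<in> borel_measurable borel"
    by (intro borel_measurable_continuous_onI continuous_intros)
  then show ?thesis
    by (rule measurable_compose[OF X_measurable])
qed

definition shifted_law :: "ell2 \<Rightarrow> ell2 measure" where
  "shifted_law u = distr M borel (\<lambda>\<omega>. X \<omega> + u)"

lemma sets_shifted_law [simp, measurable_cong]: "sets (shifted_law u) = sets borel"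
  by (simp add: shifted_law_def)

lemma space_shifted_law [simp]: "space (shifted_law u) = UNIV"
  by (simp add: shifted_law_def)

lemma prob_space_shifted_law: "prob_space (shifted_law u)"
  unfolding shifted_law_def by (rule prob_space_distr) measurable

text \<open>Almost surely coordinate \<open>k\<close> is
  \<open>q k * \<xi> k \<omega> + coord u k\<close>, and these are independent. All later integrals
  against shifted laws reduce to one-dimensional ones in this way.\<close>

lemma nn_integral_shifted_law_prod:
  fixes g :: "nat \<Rightarrow> real \<Rightarrow> ennreal"
  assumes g [measurable]: "\<And>k. g k \<in> borel_measurable borel"
  shows "(\<integral>\<^sup>+z. (\<Prod>k<N. g k (coord z k)) \<partial>shifted_law u)
    = (\<Prod>k<N. \<integral>\<^sup>+x. ennreal (p x) * g k (q k * x + coord u k) \<partial>lborel)"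
proof -
  have "(\<integral>\<^sup>+z. (\<Prod>k<N. g k (coord z k)) \<partial>shifted_law u)
      = (\<integral>\<^sup>+\<omega>. (\<Prod>k<N. g k (coord (X \<omega> + u) k)) \<partial>M)"
    unfolding shifted_law_def by (rule nn_integral_distr) measurable
  also have "\<dots> = (\<integral>\<^sup>+\<omega>. (\<Prod>k<N. g k (q k * \<xi> k \<omega> + coord u k)) \<partial>M)"
    by (intro nn_integral_cong_AE, use sq_summable in eventually_elim)
      (simp add: plus_ell2.rep_eq X_def coord_to_ell2)
  also have "\<dots> = (\<Prod>k<N. \<integral>\<^sup>+\<omega>. g k (q k * \<xi> k \<omega> + coord u k) \<partial>M)"
    by (intro indep_vars_nn_integral indep_vars_compose2[OF indep_vars_subset[OF indep]]) auto
  also have "\<dots> = (\<Prod>k<N. \<integral>\<^sup>+x. ennreal (p x) * g k (q k * x + coord u k) \<partial>lborel)"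
  proof (intro prod.cong refl)
    fix k
    have "(\<integral>\<^sup>+\<omega>. g k (q k * \<xi> k \<omega> + coord u k) \<partial>M) = (\<integral>\<^sup>+x. g k (q k * x + coord u k) \<partial>distr M borel (\<xi> k))"
      by (rule nn_integral_distr[symmetric]) measurable
    also have "\<dots> = (\<integral>\<^sup>+x. ennreal (p x) * g k (q k * x + coord u k) \<partial>lborel)"
      by (simp add: law nn_integral_density)
    finally show "(\<integral>\<^sup>+\<omega>. g k (q k * \<xi> k \<omega> + coord u k) \<partial>M) = \<dots>" .
  qed
  finally show ?thesis .
qed

lemma nn_integral_p: "(\<integral>\<^sup>+x. ennreal (p x) \<partial>lborel) = 1"
proof -
  interpret D: prob_space "distr M borel (\<xi> 0)" by (rule prob_space_distr) measurable
  show ?thesis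
    using D.emeasure_space_1 by (simp add: law emeasure_density)
qed

section \<open>Partial likelihood ratios\<close>

definition lratio :: "ell2 \<Rightarrow> ell2 \<Rightarrow> nat \<Rightarrow> real \<Rightarrow> real" where
  "lratio u v k x = p ((x - coord u k) / q k) / p ((x - coord v k) / q k)"

lemma lratio_measurable [measurable]: "lratio u v k \<in> borel_measurable borel"
  unfolding lratio_def[abs_def] by measurable

lemma lratio_nonneg: "0 \<le> lratio u v k x"
  by (simp add: lratio_def p_nonneg)

lemma lratio_shift:
  "lratio u v k (q k * x + coord v k) = p (x - (coord u k - coord v k) / q k) / p x"
  using q_pos[of k] by (simp add: lratio_def field_simps)

text \<open>A factor with vanishing denominator is 0 by the convention for division;
  \<open>p_pos\<close> confines this to a null set of the law shifted by \<open>v\<close>.\<close>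

definition lik :: "ell2 \<Rightarrow> ell2 \<Rightarrow> nat \<Rightarrow> ell2 \<Rightarrow> real" where
  "lik u v N z = (\<Prod>k<N. lratio u v k (coord z k))"

lemma lik_measurable [measurable]: "lik u v N \<in> borel_measurable borel"
  unfolding lik_def[abs_def] by measurable

lemma lik_nonneg: "0 \<le> lik u v N z"
  unfolding lik_def by (intro prod_nonneg lratio_nonneg)

text \<open>In each coordinate the weight \<open>p x\<close> cancels the denominator and leaves
  \<open>p (x - a)\<close>; translating by \<open>a = (coord u k - coord v k) / q k\<close> then
  exchanges the shift by \<open>v\<close> for the shift by \<open>u\<close>.\<close>

lemma nn_integral_lik_rectangle:
  assumes A: "\<And>k. A k \<in> sets borel"
  shows "(\<integral>\<^sup>+z. ennreal (lik u v N z) * indicator {z. \<forall>k<N. coord z k \<in> A k} z \<partial>shifted_law v)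
    = emeasure (shifted_law u) {z. \<forall>k<N. coord z k \<in> A k}"
proof -
  note [measurable] = A
  have ind: "indicator {z. \<forall>k<N. coord z k \<in> A k} z = (\<Prod>k<N. indicator (A k) (coord z k) :: ennreal)" for z
    by (auto simp: indicator_def)
  have "(\<integral>\<^sup>+z. ennreal (lik u v N z) * indicator {z. \<forall>k<N. coord z k \<in> A k} z \<partial>shifted_law v)
      = (\<integral>\<^sup>+z. (\<Prod>k<N. ennreal (lratio u v k (coord z k)) * indicator (A k) (coord z k)) \<partial>shifted_law v)"
    unfolding ind by (simp add: lik_def prod.distrib prod_ennreal lratio_nonneg)
  also have "\<dots> = (\<Prod>k<N. \<integral>\<^sup>+x. ennreal (p x) *
      (ennreal (lratio u v k (q k * x + coord v k)) * indicator (A k) (q k * x + coord v k)) \<partial>lborel)"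
    by (rule nn_integral_shifted_law_prod) measurable
  also have "\<dots> = (\<Prod>k<N. \<integral>\<^sup>+x. ennreal (p x) * indicator (A k) (q k * x + coord u k) \<partial>lborel)"
  proof (intro prod.cong refl)
    fix k
    define a where "a = (coord u k - coord v k) / q k"
    have "(\<integral>\<^sup>+x. ennreal (p x) * (ennreal (lratio u v k (q k * x + coord v k)) * indicator (A k) (q k * x + coord v k)) \<partial>lborel)
       = (\<integral>\<^sup>+x. ennreal (p (x - a)) * indicator (A k) (q k * x + coord v k) \<partial>lborel)"
      by (intro nn_integral_cong_AE, use p_pos in eventually_elim)
        (simp add: lratio_shift a_def[symmetric] mult.assoc[symmetric] ennreal_mult'[symmetric])
    also have "\<dots> = (\<integral>\<^sup>+x. ennreal (p x) * indicator (A k) (q k * (a + x) + coord v k) \<partial>lborel)"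
      by (subst nn_integral_real_affine[where t=a and c=1]) auto
    also have "\<dots> = (\<integral>\<^sup>+x. ennreal (p x) * indicator (A k) (q k * x + coord u k) \<partial>lborel)"
    proof -
      have "q k * (a + x) + coord v k = q k * x + coord u k" for x
        using q_pos[of k] by (simp add: a_def distrib_left)
      then show ?thesis by simp
    qed
    finally show "(\<integral>\<^sup>+x. ennreal (p x) * (ennreal (lratio u v k (q k * x + coord v k)) * indicator (A k) (q k * x + coord v k)) \<partial>lborel) = \<dots>" .
  qed
  also have "\<dots> = (\<integral>\<^sup>+z. (\<Prod>k<N. indicator (A k) (coord z k)) \<partial>shifted_law u)"
    by (rule nn_integral_shifted_law_prod[symmetric]) measurable
  also have "\<dots> = emeasure (shifted_law u) {z. \<forall>k<N. coord z k \<in> A k}"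
    unfolding ind[symmetric] by (rule nn_integral_indicator) measurable
  finally show ?thesis .
qed

lemma nn_integral_lik: "(\<integral>\<^sup>+z. ennreal (lik u v N z) \<partial>shifted_law v) = 1"
  using nn_integral_lik_rectangle[where A="\<lambda>_. UNIV" and u=u and v=v and N=N] prob_space.emeasure_space_1[OF prob_space_shifted_law[of u]]
  by simp

lemma integrable_lik: "integrable (shifted_law v) (lik u v N)"
  by (intro integrableI_nonneg) (auto simp: lik_nonneg nn_integral_lik)

lemma integral_lik: "(\<integral>z. lik u v N z \<partial>shifted_law v) = 1"
  by (subst integral_eq_nn_integral) (auto simp: lik_nonneg nn_integral_lik)

section \<open>Hellinger affinities of translates and of partial likelihood ratios\<close>

definition aff :: "real \<Rightarrow> real" where
  "aff a = enn2real (\<integral>\<^sup>+x. ennreal (sqrt (p (x - a) * p x)) \<partial>lborel)"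

text \<open>Pointwise AM-GM, integrated against two densities of mass 1. This makes the affinities
  legitimate factors in Weierstrass's inequality.\<close>

lemma nn_integral_affinity_le_1: "(\<integral>\<^sup>+x. ennreal (sqrt (p (x - a) * p x)) \<partial>lborel) \<le> 1"
proof -
  have sh: "(\<integral>\<^sup>+x. ennreal (p (x - a)) \<partial>lborel) = 1"
    using nn_integral_real_affine[where t="-a" and c=1 and f="\<lambda>x. ennreal (p x)"] nn_integral_p by simp
  have "2 * (\<integral>\<^sup>+x. ennreal (sqrt (p (x - a) * p x)) \<partial>lborel) = (\<integral>\<^sup>+x. 2 * ennreal (sqrt (p (x - a) * p x)) \<partial>lborel)"
    by (rule nn_integral_cmult[symmetric]) measurable
  also have "\<dots> \<le> (\<integral>\<^sup>+x. ennreal (p (x - a)) + ennreal (p x) \<partial>lborel)"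
  proof (intro nn_integral_mono)
    fix x
    have "2 * sqrt (p (x - a) * p x) \<le> p (x - a) + p x"
      using arith_geo_mean_sqrt[of "p (x - a)" "p x"] p_nonneg by simp
    then have "ennreal (2 * sqrt (p (x - a) * p x)) \<le> ennreal (p (x - a) + p x)"
      by (rule ennreal_leI)
    then show "2 * ennreal (sqrt (p (x - a) * p x)) \<le> ennreal (p (x - a)) + ennreal (p x)"
      by (simp add: p_nonneg ennreal_mult')
  qed
  also have "\<dots> = (\<integral>\<^sup>+x. ennreal (p (x - a)) \<partial>lborel) + (\<integral>\<^sup>+x. ennreal (p x) \<partial>lborel)"
    by (rule nn_integral_add) auto
  also have "\<dots> = 2" by (simp add: sh nn_integral_p)
  finally have le: "2 * (\<integral>\<^sup>+x. ennreal (sqrt (p (x - a) * p x)) \<partial>lborel) \<le> 2" .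
  show ?thesis
  proof (cases "\<integral>\<^sup>+x. ennreal (sqrt (p (x - a) * p x)) \<partial>lborel")
    case (real r)
    have "ennreal (2 * r) \<le> ennreal 2" using le real by (simp add: ennreal_mult')
    then have "2 * r \<le> 2" by (subst (asm) ennreal_le_iff) auto
    then show ?thesis using real by (simp add: ennreal_le_1)
  next
    case top
    then show ?thesis using le by (simp add: ennreal_mult_top top_unique)
  qed
qed

lemma ennreal_aff: "(\<integral>\<^sup>+x. ennreal (sqrt (p (x - a) * p x)) \<partial>lborel) = ennreal (aff a)"
  unfolding aff_def using le_less_trans[OF nn_integral_affinity_le_1[of a]] by simp

lemma aff_nonneg: "0 \<le> aff a"
  by (simp add: aff_def)

lemma aff_le_1: "aff a \<le> 1"
  using nn_integral_affinity_le_1[of a] unfolding ennreal_aff by (simp add: ennreal_le_1)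

lemma aff_ge: "1 - C * a\<^sup>2 \<le> aff a"
  unfolding aff_def by (rule affinity)

text \<open>Factors below \<open>n\<close> occur in both products, so the root leaves a full ratio,
  with integral 1. Those from \<open>n\<close> on occur once, and the root of a single ratio
  integrates to an affinity.\<close>

lemma nn_integral_sqrt_lik:
  assumes "n \<le> N"
  shows "(\<integral>\<^sup>+z. ennreal (sqrt (lik u v n z * lik u v N z)) \<partial>shifted_law v)
    = ennreal (\<Prod>k=n..<N. aff ((coord u k - coord v k) / q k))"
proof -
  define g where "g k x = ennreal (if k < n then lratio u v k x else sqrt (lratio u v k x))" for k x
  have split: "{..<N} = {..<n} \<union> {n..<N}" using assms by auto
  have "sqrt (lik u v n z * lik u v N z)
      = lik u v n z * (\<Prod>k=n..<N. sqrt (lratio u v k (coord z k)))" for z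
  proof -
    have "lik u v N z = lik u v n z * (\<Prod>k=n..<N. lratio u v k (coord z k))"
      unfolding lik_def split by (rule prod.union_disjoint) auto
    then have "lik u v n z * lik u v N z = (lik u v n z)\<^sup>2 * (\<Prod>k=n..<N. lratio u v k (coord z k))"
      by (simp add: power2_eq_square)
    moreover have "sqrt (prod h A) = (\<Prod>k\<in>A. sqrt (h k))" for h :: "nat \<Rightarrow> real" and A
      by (induction A rule: infinite_finite_induct) (auto simp: real_sqrt_mult)
    ultimately show ?thesis
      by (simp add: real_sqrt_mult lik_nonneg)
  qed
  moreover have "(\<Prod>k<N. g k (coord z k))
      = ennreal (lik u v n z * (\<Prod>k=n..<N. sqrt (lratio u v k (coord z k))))" for z
    unfolding split
    by (subst prod.union_disjoint) (auto simp: g_def lik_def prod_ennreal lratio_nonneg ennreal_mult prod_nonneg)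
  ultimately have "(\<integral>\<^sup>+z. ennreal (sqrt (lik u v n z * lik u v N z)) \<partial>shifted_law v)
      = (\<integral>\<^sup>+z. (\<Prod>k<N. g k (coord z k)) \<partial>shifted_law v)"
    by simp
  also have "\<dots> = (\<Prod>k<N. \<integral>\<^sup>+x. ennreal (p x) * g k (q k * x + coord v k) \<partial>lborel)"
    by (rule nn_integral_shifted_law_prod) (simp add: g_def[abs_def])
  also have "\<dots> = (\<Prod>k<N. ennreal (if k < n then 1 else aff ((coord u k - coord v k) / q k)))"
  proof (intro prod.cong refl)
    fix k
    define a where "a = (coord u k - coord v k) / q k"
    show "(\<integral>\<^sup>+x. ennreal (p x) * g k (q k * x + coord v k) \<partial>lborel)
        = ennreal (if k < n then 1 else aff ((coord u k - coord v k) / q k))"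
    proof (cases "k < n")
      case True
      have "(\<integral>\<^sup>+x. ennreal (p x) * g k (q k * x + coord v k) \<partial>lborel) = (\<integral>\<^sup>+x. ennreal (p (x - a)) \<partial>lborel)"
        using True by (intro nn_integral_cong_AE, use p_pos in eventually_elim)
          (simp add: g_def lratio_shift a_def[symmetric] ennreal_mult'[symmetric])
      also have "\<dots> = 1"
        using nn_integral_real_affine[where t="-a" and c=1 and f="\<lambda>x. ennreal (p x)"] nn_integral_p by simp
      finally show ?thesis using True by simp
    next
      case False
      have "(\<integral>\<^sup>+x. ennreal (p x) * g k (q k * x + coord v k) \<partial>lborel)
          = (\<integral>\<^sup>+x. ennreal (sqrt (p (x - a) * p x)) \<partial>lborel)"
      proof (intro nn_integral_cong_AE, use p_pos in eventually_elim)
        fix x assume x: "0 < p x"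
        have "p x * sqrt (p (x - a) / p x) = sqrt (p (x - a) * p x)"
          using x by (simp add: real_sqrt_mult real_sqrt_divide field_simps)
        then show "ennreal (p x) * g k (q k * x + coord v k) = ennreal (sqrt (p (x - a) * p x))"
          using False x by (simp add: g_def lratio_shift a_def[symmetric] ennreal_mult'[symmetric])
      qed
      then show ?thesis using False by (simp add: ennreal_aff a_def)
    qed
  qed
  also have "\<dots> = ennreal (\<Prod>k<N. if k < n then 1 else aff ((coord u k - coord v k) / q k))"
    by (rule prod_ennreal) (simp add: aff_nonneg)
  also have "(\<Prod>k<N. if k < n then 1 else aff ((coord u k - coord v k) / q k))
      = (\<Prod>k=n..<N. aff ((coord u k - coord v k) / q k))"
    unfolding split by (subst prod.union_disjoint) auto
  finally show ?thesis .
qed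

text \<open>The bound comes from \<open>\<bar>a - b\<bar> \<le> (a + b - 2 * sqrt (a * b)) / (2 * c) + c * (a + b)\<close>, i.e.
  AM--GM for the factorisation of \<open>a - b\<close> into \<open>sqrt a - sqrt b\<close> and \<open>sqrt a + sqrt b\<close>.\<close>

lemma integral_abs_lik_diff_le:
  assumes nN: "n \<le> N" and c: "0 < c"
  shows "(\<integral>z. \<bar>lik u v n z - lik u v N z\<bar> \<partial>shifted_law v)
    \<le> C * (\<Sum>k=n..<N. ((coord u k - coord v k) / q k)\<^sup>2) / c + 2 * c"
proof -
  let ?s = "\<lambda>z. sqrt (lik u v n z * lik u v N z)"
  define P where "P = (\<Prod>k=n..<N. aff ((coord u k - coord v k) / q k))"
  have P0: "0 \<le> P" unfolding P_def by (intro prod_nonneg aff_nonneg)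
  have s: "integrable (shifted_law v) ?s" "(\<integral>z. ?s z \<partial>shifted_law v) = P"
    using nn_integral_sqrt_lik[OF nN, where u=u and v=v] P0
    by (auto intro!: integrableI_nonneg simp: P_def integral_eq_nn_integral lik_nonneg)
  have "(\<integral>z. \<bar>lik u v n z - lik u v N z\<bar> \<partial>shifted_law v)
      \<le> (\<integral>z. (lik u v n z + lik u v N z - 2 * ?s z) / (2 * c) + c * (lik u v n z + lik u v N z) \<partial>shifted_law v)"
  proof (rule integral_mono)
    fix z
    define x where "x = sqrt (lik u v n z)"
    define y where "y = sqrt (lik u v N z)"
    have xy: "0 \<le> x" "0 \<le> y" "lik u v n z = x\<^sup>2" "lik u v N z = y\<^sup>2" "?s z = x * y"
      by (auto simp: x_def y_def lik_nonneg real_sqrt_mult)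
    have "\<bar>x\<^sup>2 - y\<^sup>2\<bar> = \<bar>x - y\<bar> * (x + y)"
      using xy by (simp add: power2_eq_square square_diff_square_factored abs_mult mult.commute)
    also have "\<dots> \<le> (x - y)\<^sup>2 / (2 * c) + c / 2 * (x + y)\<^sup>2"
    proof -
      have "0 \<le> (\<bar>x - y\<bar> - c * (x + y))\<^sup>2" by simp
      then have "2 * c * (\<bar>x - y\<bar> * (x + y)) \<le> (x - y)\<^sup>2 + c\<^sup>2 * (x + y)\<^sup>2"
        by (simp add: power2_diff power_mult_distrib mult_ac)
      then show ?thesis using c by (simp add: field_simps power2_eq_square)
    qed
    also have "\<dots> \<le> (x\<^sup>2 + y\<^sup>2 - 2 * (x * y)) / (2 * c) + c * (x\<^sup>2 + y\<^sup>2)"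
    proof -
      have "0 \<le> (x - y)\<^sup>2" by simp
      then have "(x + y)\<^sup>2 \<le> 2 * (x\<^sup>2 + y\<^sup>2)" by (simp add: power2_sum power2_diff)
      then have "c / 2 * (x + y)\<^sup>2 \<le> c / 2 * (2 * (x\<^sup>2 + y\<^sup>2))" using c by (intro mult_left_mono) auto
      then show ?thesis by (simp add: power2_diff algebra_simps)
    qed
    finally show "\<bar>lik u v n z - lik u v N z\<bar>
      \<le> (lik u v n z + lik u v N z - 2 * ?s z) / (2 * c) + c * (lik u v n z + lik u v N z)"
      using xy by (simp add: real_sqrt_mult)
  qed (use integrable_lik s in auto)
  also have "\<dots> = (1 + 1 - 2 * P) / (2 * c) + c * (1 + 1)"
    by (simp add: integrable_lik s integral_lik)
  also have "\<dots> = (1 - P) / c + 2 * c"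
    using c by (simp add: field_simps)
  \<comment> \<open>By Weierstrass's inequality \<open>1 - P\<close> is at most the sum of the
    deficits \<open>1 - aff\<close>, each quadratic in the normalized shift by
    \<open>aff_ge\<close>.\<close>
  also have "\<dots> \<le> C * (\<Sum>k=n..<N. ((coord u k - coord v k) / q k)\<^sup>2) / c + 2 * c"
  proof -
    have "1 - (\<Sum>k=n..<N. 1 - aff ((coord u k - coord v k) / q k)) \<le> P"
      unfolding P_def by (intro one_minus_sum_le_prod) (auto simp: aff_nonneg aff_le_1)
    moreover have "(\<Sum>k=n..<N. 1 - aff ((coord u k - coord v k) / q k))
        \<le> (\<Sum>k=n..<N. C * ((coord u k - coord v k) / q k)\<^sup>2)"
      by (intro sum_mono) (use aff_ge in \<open>simp add: algebra_simps\<close>)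
    ultimately have "1 - P \<le> C * (\<Sum>k=n..<N. ((coord u k - coord v k) / q k)\<^sup>2)"
      by (simp add: sum_distrib_left)
    then show ?thesis using c by (simp add: divide_right_mono)
  qed
  finally show ?thesis .
qed

section \<open>The limit of the likelihood ratios as a density\<close>

lemma lik_L1_Cauchy:
  assumes sm: "summable (\<lambda>k. ((coord u k - coord v k) / q k)\<^sup>2)" and e: "0 < e"
  shows "\<exists>N. \<forall>i\<ge>N. \<forall>j\<ge>N. (\<integral>z. \<bar>lik u v i z - lik u v j z\<bar> \<partial>shifted_law v) < e"
proof -
  \<comment> \<open>In the bound of \<open>integral_abs_lik_diff_le\<close>, \<open>2 * c\<close> is
    \<open>e / 2\<close> and \<open>d\<close> makes the other term at most \<open>e / 4\<close>. The
    factor \<open>C + 1\<close> covers the case \<open>C = 0\<close>.\<close>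
  define c where "c = e / 4"
  define d where "d = e * c / (4 * (C + 1))"
  have c: "0 < c" and d: "0 < d" using e C_nonneg by (auto simp: c_def d_def)
  obtain N where N: "\<And>m n. N \<le> m \<Longrightarrow> norm (\<Sum>k=m..<n. ((coord u k - coord v k) / q k)\<^sup>2) < d"
    using sm d unfolding summable_Cauchy by blast
  have main: "(\<integral>z. \<bar>lik u v i z - lik u v j z\<bar> \<partial>shifted_law v) < e" if "N \<le> i" "i \<le> j" for i j
  proof -
    let ?S = "\<Sum>k=i..<j. ((coord u k - coord v k) / q k)\<^sup>2"
    have S: "0 \<le> ?S" "?S < d" using N[OF that(1), of j] by (auto intro: sum_nonneg)
    have "C * ?S \<le> (C + 1) * d"
      using S C_nonneg d by (intro mult_mono) auto
    also have "\<dots> = e / 4 * c" using C_nonneg by (simp add: d_def field_simps)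
    finally have "C * ?S / c \<le> e / 4" using c by (simp add: field_simps)
    then show ?thesis
      using integral_abs_lik_diff_le[OF that(2) c, where u=u and v=v] e by (simp add: c_def)
  qed
  show ?thesis
  proof (intro exI[of _ N] allI impI)
    fix i j assume "N \<le> i" "N \<le> j"
    then show "(\<integral>z. \<bar>lik u v i z - lik u v j z\<bar> \<partial>shifted_law v) < e"
      using main[of i j] main[of j i] by (cases "i \<le> j") (auto simp: abs_minus_commute)
  qed
qed

text \<open>Convergence in L1 preserves integrals over a fixed cylinder, where the approximants
  eventually reproduce the law shifted by \<open>u\<close>; cylinders determine the measure.\<close>

lemma shifted_law_density:
  assumes sm: "summable (\<lambda>k. ((coord u k - coord v k) / q k)\<^sup>2)"
  obtains f where "f \<in> borel_measurable borel" "\<And>z. 0 \<le> f z" "integrable (shifted_law v) f"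
    "(\<lambda>n. \<integral>z. \<bar>lik u v n z - f z\<bar> \<partial>shifted_law v) \<longlonglongrightarrow> 0"
    "shifted_law u = density (shifted_law v) (\<lambda>z. ennreal (f z))"
proof -
  obtain f0 where f0: "integrable (shifted_law v) f0"
    and lim0: "(\<lambda>n. \<integral>z. \<bar>lik u v n z - f0 z\<bar> \<partial>shifted_law v) \<longlonglongrightarrow> 0"
    using L1_Cauchy_imp_convergent[OF integrable_lik lik_L1_Cauchy[OF sm]] by blast
  \<comment> \<open>The positive part is nonnegative everywhere and, since \<open>lik\<close> is
    nonnegative, no farther from it than \<open>f0\<close>.\<close>
  define f where "f z = max (f0 z) 0" for z
  have f: "integrable (shifted_law v) f" unfolding f_def using f0 by simp
  have fm [measurable]: "f \<in> borel_measurable borel"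
    using borel_measurable_integrable[OF f] by simp
  have f_nn: "0 \<le> f z" for z by (simp add: f_def)
  have lim: "(\<lambda>n. \<integral>z. \<bar>lik u v n z - f z\<bar> \<partial>shifted_law v) \<longlonglongrightarrow> 0"
  proof (rule Lim_null_comparison[OF _ lim0], intro always_eventually allI)
    fix n
    have "(\<integral>z. \<bar>lik u v n z - f z\<bar> \<partial>shifted_law v) \<le> (\<integral>z. \<bar>lik u v n z - f0 z\<bar> \<partial>shifted_law v)"
      by (intro integral_mono integrable_abs Bochner_Integration.integrable_diff integrable_lik f f0)
        (smt (verit, best) f_def lik_nonneg)
    then show "norm (\<integral>z. \<bar>lik u v n z - f z\<bar> \<partial>shifted_law v) \<le> (\<integral>z. \<bar>lik u v n z - f0 z\<bar> \<partial>shifted_law v)"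
      by simp
  qed
  have "shifted_law u = density (shifted_law v) (\<lambda>z. ennreal (f z))"
  proof (rule ell2_measure_eqI)
    interpret U: prob_space "shifted_law u" by (rule prob_space_shifted_law)
    show "finite_measure (shifted_law u)" by unfold_locales
    fix n and A :: "nat \<Rightarrow> real set" assume A: "\<And>k. A k \<in> sets borel"
    note [measurable] = A
    define R where "R = {z. \<forall>k<n. coord z k \<in> A k}"
    have R [measurable]: "R \<in> sets borel"
      unfolding R_def by measurable
    have eq: "(\<integral>z. lik u v N z * indicator R z \<partial>shifted_law v) = measure (shifted_law u) R" if "n \<le> N" for N
    proof -
      have "{z. \<forall>k<N. coord z k \<in> (if k < n then A k else UNIV)} = R"
        using that by (auto simp: R_def)
      then have "(\<integral>\<^sup>+z. ennreal (lik u v N z) * indicator R z \<partial>shifted_law v) = emeasure (shifted_law u) R"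
        using nn_integral_lik_rectangle[where A="\<lambda>k. if k < n then A k else UNIV" and u=u and v=v and N=N] by simp
      then show ?thesis
        by (subst integral_eq_nn_integral)
          (auto simp: lik_nonneg measure_def ennreal_mult' ennreal_indicator)
    qed
    have intR: "integrable (shifted_law v) (\<lambda>z. g z * indicator R z)" if "integrable (shifted_law v) g" for g :: "ell2 \<Rightarrow> real"
      using that by (intro integrable_real_mult_indicator) auto
    have "(\<lambda>N. \<integral>z. lik u v N z * indicator R z \<partial>shifted_law v) \<longlonglongrightarrow> (\<integral>z. f z * indicator R z \<partial>shifted_law v)"
    proof (rule LIM_zero_cancel, rule Lim_null_comparison[OF _ lim], intro always_eventually allI)
      fix N
      have "norm ((\<integral>z. lik u v N z * indicator R z \<partial>shifted_law v) - (\<integral>z. f z * indicator R z \<partial>shifted_law v))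
          = \<bar>\<integral>z. lik u v N z * indicator R z - f z * indicator R z \<partial>shifted_law v\<bar>"
        by (simp add: intR f integrable_lik)
      also have "\<dots> \<le> (\<integral>z. \<bar>lik u v N z * indicator R z - f z * indicator R z\<bar> \<partial>shifted_law v)"
        by (rule integral_abs_bound)
      also have "\<dots> \<le> (\<integral>z. \<bar>lik u v N z - f z\<bar> \<partial>shifted_law v)"
        by (intro integral_mono integrable_abs Bochner_Integration.integrable_diff intR integrable_lik f)
          (auto simp: indicator_def)
      finally show "norm ((\<integral>z. lik u v N z * indicator R z \<partial>shifted_law v) - (\<integral>z. f z * indicator R z \<partial>shifted_law v))
          \<le> (\<integral>z. \<bar>lik u v N z - f z\<bar> \<partial>shifted_law v)" .
    qed
    \<comment> \<open>The sequence is constant from \<open>N = n\<close> on.\<close>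
    moreover have "(\<lambda>N. \<integral>z. lik u v N z * indicator R z \<partial>shifted_law v) \<longlonglongrightarrow> measure (shifted_law u) R"
      by (rule tendsto_eventually) (auto simp: eventually_sequentially intro!: exI[of _ n] eq)
    ultimately have "(\<integral>z. f z * indicator R z \<partial>shifted_law v) = measure (shifted_law u) R"
      by (rule LIMSEQ_unique)
    then have "(\<integral>\<^sup>+z. ennreal (f z * indicator R z) \<partial>shifted_law v) = ennreal (measure (shifted_law u) R)"
      by (subst nn_integral_eq_integral) (auto simp: intR f f_nn)
    then show "emeasure (shifted_law u) {z. \<forall>k<n. coord z k \<in> A k}
      = emeasure (density (shifted_law v) (\<lambda>z. ennreal (f z))) {z. \<forall>k<n. coord z k \<in> A k}"
      unfolding R_def[symmetric]
      by (simp add: emeasure_density U.emeasure_eq_measure ennreal_mult' f_nn ennreal_indicator)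
  qed simp_all
  with fm f_nn f lim show ?thesis by (rule that)
qed

lemma shifted_law_absolutely_continuous:
  assumes sm: "summable (\<lambda>k. ((coord u k - coord v k) / q k)\<^sup>2)"
  shows "absolutely_continuous (shifted_law v) (shifted_law u)"
proof -
  obtain f where "f \<in> borel_measurable borel" "shifted_law u = density (shifted_law v) (\<lambda>z. ennreal (f z))"
    using shifted_law_density[OF sm] by metis
  then show ?thesis
    by (simp add: absolutely_continuousI_density)
qed

text \<open>The summability condition is symmetric in \<open>u\<close> and \<open>v\<close>, so a
  density exists in both directions.\<close>

lemma shifted_laws_equivalent:
  assumes sm: "summable (\<lambda>k. ((coord u k - coord v k) / q k)\<^sup>2)"
  shows "equivalent_measures (shifted_law u) (shifted_law v)"
proof -
  have "summable (\<lambda>k. ((coord v k - coord u k) / q k)\<^sup>2)"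
    using sm by (simp only: power_divide power2_commute[of "coord v k" "coord u k" for k])
  then show ?thesis
    using shifted_law_absolutely_continuous[OF sm] shifted_law_absolutely_continuous
    by (auto simp: equivalent_measures_def)
qed

text \<open>Densities are unique almost everywhere, so the limit found above is the Radon-Nikodym
  derivative.\<close>

lemma lik_tendsto_RN_deriv:
  assumes sm: "summable (\<lambda>k. ((coord u k - coord v k) / q k)\<^sup>2)"
  shows "tendsto_in_L1 (shifted_law v) (lik u v)
    (\<lambda>z. enn2real (RN_deriv (shifted_law v) (shifted_law u) z))"
proof -
  obtain f where fm [measurable]: "f \<in> borel_measurable borel" and f_nn: "\<And>z. 0 \<le> f z"
    and f: "integrable (shifted_law v) f"
    and lim: "(\<lambda>n. \<integral>z. \<bar>lik u v n z - f z\<bar> \<partial>shifted_law v) \<longlonglongrightarrow> 0"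
    and dens: "shifted_law u = density (shifted_law v) (\<lambda>z. ennreal (f z))"
    by (rule shifted_law_density[OF sm], rule that)
  interpret V: prob_space "shifted_law v" by (rule prob_space_shifted_law)
  have "AE z in shifted_law v. ennreal (f z) = RN_deriv (shifted_law v) (shifted_law u) z"
    by (rule V.RN_deriv_unique) (auto simp: dens)
  then have ae: "AE z in shifted_law v. enn2real (RN_deriv (shifted_law v) (shifted_law u) z) = f z"
    by eventually_elim (metis enn2real_ennreal f_nn)
  show ?thesis
    unfolding tendsto_in_L1_def
  proof (intro conjI allI)
    show "integrable (shifted_law v) (lik u v N)" for N by (rule integrable_lik)
    show "integrable (shifted_law v) (\<lambda>z. enn2real (RN_deriv (shifted_law v) (shifted_law u) z))"
      using f ae by (subst integrable_cong_AE[where g=f]) auto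
    have "(\<integral>z. \<bar>lik u v N z - enn2real (RN_deriv (shifted_law v) (shifted_law u) z)\<bar> \<partial>shifted_law v)
        = (\<integral>z. \<bar>lik u v N z - f z\<bar> \<partial>shifted_law v)" for N
      by (intro integral_cong_AE, measurable, use ae in eventually_elim) simp
    then show "(\<lambda>N. \<integral>z. \<bar>lik u v N z - enn2real (RN_deriv (shifted_law v) (shifted_law u) z)\<bar> \<partial>shifted_law v) \<longlonglongrightarrow> 0"
      using lim by simp
  qed
qed

end

text \<open>Almost sure square-summability belongs to the claim because it confines the default
  value of \<open>to_ell2\<close> to a null set, so that both laws are those of the shifted
  sequences themselves.\<close>

theorem theorem3p4:
  fixes M :: "'a measure"
    and \<xi> :: "nat \<Rightarrow> 'a \<Rightarrow> real"
    and m\<^sub>\<alpha> :: "real measure"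
    and p\<^sub>\<alpha> :: "real \<Rightarrow> real"
    and \<alpha> :: real
    and q :: "nat \<Rightarrow> real"
    and u v :: ell2
  assumes "prob_space M"
    and "0 < \<alpha>" and "\<alpha> \<le> 2"
    and "symmetric_stable_law \<alpha> m\<^sub>\<alpha>"
    and "lborel_density_of m\<^sub>\<alpha> p\<^sub>\<alpha>"
    and "prob_space.indep_vars M (\<lambda>_. borel) \<xi> UNIV"
    and "\<And>k. distr M borel (\<xi> k) = m\<^sub>\<alpha>"
    and "\<And>k. 0 < q k"
    and "summable (\<lambda>k. q k powr \<alpha>)"
    and "summable (\<lambda>k. \<bar>coord u k - coord v k\<bar>\<^sup>2 / (q k)\<^sup>2)"
  shows "let X = (\<lambda>\<omega>. to_ell2 (\<lambda>k. q k * \<xi> k \<omega>));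
             \<mu> = distr M borel (\<lambda>\<omega>. X \<omega> + u);
             \<nu> = distr M borel (\<lambda>\<omega>. X \<omega> + v)
         in (AE \<omega> in M. summable (\<lambda>k. (q k * \<xi> k \<omega>)\<^sup>2)) \<and>
            X \<in> borel_measurable M \<and>
            equivalent_measures \<mu> \<nu> \<and>
            tendsto_in_L1 \<nu>
              (\<lambda>N z. \<Prod>k<N. p\<^sub>\<alpha> ((coord z k - coord u k) / q k) / p\<^sub>\<alpha> ((coord z k - coord v k) / q k))
              (\<lambda>z. enn2real (RN_deriv \<nu> \<mu> z))"
proof -
  note M = assms(1) and \<alpha> = assms(2,3) and stab = assms(4) and dens = assms(5)
    and indep = assms(6) and law = assms(7) and q = assms(8) and sm = assms(9) and sm2 = assms(10)
  interpret prob_space M by (rule M)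
  have p: "p\<^sub>\<alpha> \<in> borel_measurable borel" "\<And>x. 0 \<le> p\<^sub>\<alpha> x"
    and m: "m\<^sub>\<alpha> = density lborel (\<lambda>x. ennreal (p\<^sub>\<alpha> x))"
    using dens by (auto simp: lborel_density_of_def)
  obtain C where C: "0 \<le> C"
    "\<And>a. 1 - C * a\<^sup>2 \<le> enn2real (\<integral>\<^sup>+x. ennreal (sqrt (p\<^sub>\<alpha> (x - a) * p\<^sub>\<alpha> x)) \<partial>lborel)"
    and pos: "AE x in lborel. 0 < p\<^sub>\<alpha> x"
    using stable_density_properties[OF \<alpha> stab dens] by blast
  have rv: "\<xi> k \<in> borel_measurable M" for k
    using indep by (simp add: indep_vars_def)
  have sq: "AE \<omega> in M. summable (\<lambda>k. (q k * \<xi> k \<omega>)\<^sup>2)"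
    by (rule AE_summable_stable_sq[OF \<alpha> stab rv law q sm])
  interpret scaled_iid_sequence M \<xi> p\<^sub>\<alpha> q C
    by unfold_locales (use indep law m p pos C q sq in auto)
  have sm3: "summable (\<lambda>k. ((coord u k - coord v k) / q k)\<^sup>2)"
    using sm2 by (simp add: power_divide)
  have L: "lik u v = (\<lambda>N z. \<Prod>k<N. p\<^sub>\<alpha> ((coord z k - coord u k) / q k) / p\<^sub>\<alpha> ((coord z k - coord v k) / q k))"
    by (simp add: fun_eq_iff lik_def lratio_def)
  show ?thesis
    using sq X_measurable shifted_laws_equivalent[OF sm3] lik_tendsto_RN_deriv[OF sm3]
    unfolding Let_def L shifted_law_def X_def[abs_def] by blast
qed

end
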